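(* Let $G$ be a Polish group and let $\mathcal{R}$ be a countable graded basis of $G$ consisting of graded cosets $Hg$ ($g\in G$) of open graded subgroups $H$ which themselves belong to $\mathcal{R}$, such that the family of graded subgroups belonging to $\mathcal{R}$ is closed under pointwise $\max$ and under dotted multiplication by positive rationals, and such that for every graded subgroup $H\in\mathcal{R}$ and every $g\in G$, if $Hg\in\mathcal{R}$ then $H^g\in\mathcal{R}$. Let $(\mathbf{X},\tau)$ be a Polish $G$-space and let $\mathcal{F}$ be a countable family of Borel graded subsets of $\mathbf{X}$ generating a topology finer than $\tau$, such that each $\phi\in\mathcal{F}$ is $H$-invariant for some graded subgroup $H\in\mathcal{R}$. Then there is an $\mathcal{R}$-nice topology for the $G$-space $(\mathbf{X},\tau)$ in which every member of $\mathcal{F}$ is an open graded subset.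
   Context: A graded subset of a space $Z$ is a function $\phi:Z\to[0,1]$; write $\phi_{<r}=\{z:\phi(z)<r\}$ and similarly $\phi_{\le r},\phi_{>r}$. It is open if upper semicontinuous (all $\phi_{<r}$ open). A family of graded subsets generates the topology with subbasis $\{\phi_{<r}\}$. A graded subgroup of $G$ is a graded subset $H$ with $H(1)=0$, $H(g)=H(g^{-1})$, $H(gg')\le H(g)+H(g')$. The graded coset $Hg$ is $h\mapsto H(hg^{-1})$, the graded conjugate $H^g$ is $h\mapsto H(ghg^{-1})$. Dotted operations: $x\dot+y=\min(x+y,1)$, $x\dot-y=\max(x-y,0)$, $q\cdot\phi=\min(q\phi,1)$, $\neg\phi=1-\phi$. A graded basis of a topology is a family $\mathcal{U}$ of open graded subsets such that $\{\phi_{<r}:\phi\in\mathcal{U},r\in\mathbb{Q}\cap(0,1)\}$ is a basis. If $G$ acts on $\mathbf{X}$, a graded subset $\phi$ of $\mathbf{X}$ is $H$-invariant if $\phi(gx)\le\phi(x)\dot+H(g)$ for all $g,x$. For an open graded subset $J$ of $G$: $\phi^{\Delta J}(x)=\inf\{r\dot+s:\{h:\phi(hx)<r\}$ is not meagre in $J_{<s}\}$ and $\phi^{*J}(x)=\sup\{r\dot-s:\{h:\phi(hx)\le r\}$ is not comeagre in $J_{<s}\}$. A family $\mathcal{B}$ of Borel graded subsets of $(\mathbf{X},\tau)$ is a nice basis with respect to $\mathcal{R}$ if: (i) $\mathcal{B}$ is countable and generates a topology finer than $\tau$; (ii) for $\phi_1,\phi_2\in\mathcal{B}$ the functions $\neg\phi_1$,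 $\min(\phi_1,\phi_2)$, $\max(\phi_1,\phi_2)$, $|\phi_1-\phi_2|$, $\phi_1\dot-\phi_2$, $\phi_1\dot+\phi_2$ are in $\mathcal{B}$; (iii) $q\cdot\phi\in\mathcal{B}$ for $\phi\in\mathcal{B}$, $q\in\mathbb{Q}^+$; (iv) $\phi^{*\rho},\phi^{\Delta\rho}\in\mathcal{B}$ for $\phi\in\mathcal{B}$, $\rho\in\mathcal{R}$; (v) each $\phi\in\mathcal{B}$ is $H$-invariant for some open graded subgroup $H\in\mathcal{R}$. A topology $\mathbf{t}$ on $\mathbf{X}$ is $\mathcal{R}$-nice if $\mathbf{t}$ is Polish, finer than $\tau$, the action of $G$ is continuous with respect to $\mathbf{t}$, and $\mathbf{t}$ has a graded basis which is a nice basis with respect to $\mathcal{R}$. *)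

theory Defs
  imports "HOL-Analysis.Analysis"
begin

(* Topological groups are rendered by the class topological_group_add: it is the class of
   arbitrary, not necessarily commutative, topological groups, written additively. Thus the
   unit is 0, the product g g' is g + g', the inverse of g is - g, and g - h is g + (- h).
   A space X carrying several topologies is a type, with each topology a value of type
   'x topology whose topspace is UNIV. *)

section \<open>Graded subsets\<close>

definition graded_subset :: "('z \<Rightarrow> real) \<Rightarrow> bool" where
  "graded_subset \<phi> \<longleftrightarrow> (\<forall>z. 0 \<le> \<phi> z \<and> \<phi> z \<le> 1)"

definition sub_less :: "('z \<Rightarrow> real) \<Rightarrow> real \<Rightarrow> 'z set" where
  "sub_less \<phi> r = {z. \<phi> z < r}"

definition open_graded_subset :: "'z topology \<Rightarrow> ('z \<Rightarrow> real) \<Rightarrow> bool" where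
  "open_graded_subset T \<phi> \<longleftrightarrow> graded_subset \<phi> \<and> (\<forall>r. openin T (sub_less \<phi> r))"

definition borel_graded_subset :: "'z topology \<Rightarrow> ('z \<Rightarrow> real) \<Rightarrow> bool" where
  "borel_graded_subset T \<phi> \<longleftrightarrow>
     graded_subset \<phi> \<and> \<phi> \<in> borel_measurable (sigma (topspace T) {U. openin T U})"

definition dotted_add :: "real \<Rightarrow> real \<Rightarrow> real" where
  "dotted_add x y = min (x + y) 1"

definition dotted_diff :: "real \<Rightarrow> real \<Rightarrow> real" where
  "dotted_diff x y = max (x - y) 0"

definition dotted_scale :: "real \<Rightarrow> ('z \<Rightarrow> real) \<Rightarrow> 'z \<Rightarrow> real" where
  "dotted_scale q \<phi> = (\<lambda>z. min (q * \<phi> z) 1)"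

definition finer_topology :: "'z topology \<Rightarrow> 'z topology \<Rightarrow> bool" where
  "finer_topology t \<tau> \<longleftrightarrow> (\<forall>U. openin \<tau> U \<longrightarrow> openin t U)"

(* UNIV is inserted because topology_generated_by takes the union of the subbasis as the
   underlying space, whereas a subbasis of a topology on the whole type need not cover it. *)
definition graded_generated_topology :: "('z \<Rightarrow> real) set \<Rightarrow> 'z topology" where
  "graded_generated_topology \<U> =
     topology_generated_by (insert UNIV {sub_less \<phi> r |\<phi> r. \<phi> \<in> \<U>})"

definition is_basis :: "'z topology \<Rightarrow> 'z set set \<Rightarrow> bool" where
  "is_basis T \<B> \<longleftrightarrow> openin T = arbitrary union_of (\<lambda>U. U \<in> \<B>)"

definition graded_basis :: "'z topology \<Rightarrow> ('z \<Rightarrow> real) set \<Rightarrow> bool" where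
  "graded_basis T \<U> \<longleftrightarrow>
     (\<forall>\<phi>\<in>\<U>. open_graded_subset T \<phi>) \<and>
     is_basis T {sub_less \<phi> r |\<phi> r. \<phi> \<in> \<U> \<and> r \<in> \<rat> \<and> 0 < r \<and> r < 1}"

section \<open>Graded subgroups\<close>

definition graded_subgroup :: "('g::group_add \<Rightarrow> real) \<Rightarrow> bool" where
  "graded_subgroup H \<longleftrightarrow>
     graded_subset H \<and> H 0 = 0 \<and> (\<forall>g. H g = H (- g)) \<and> (\<forall>g g'. H (g + g') \<le> H g + H g')"

definition graded_coset :: "('g::group_add \<Rightarrow> real) \<Rightarrow> 'g \<Rightarrow> 'g \<Rightarrow> real" where
  "graded_coset H g = (\<lambda>h. H (h + (- g)))"

definition graded_conjugate :: "('g::group_add \<Rightarrow> real) \<Rightarrow> 'g \<Rightarrow> 'g \<Rightarrow> real" where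
  "graded_conjugate H g = (\<lambda>h. H (g + h + (- g)))"

section \<open>Polish spaces and Polish G-spaces\<close>

definition polish_topology :: "'x topology \<Rightarrow> bool" where
  "polish_topology \<tau> \<longleftrightarrow>
     topspace \<tau> = UNIV \<and> completely_metrizable_space \<tau> \<and> second_countable \<tau>"

definition is_action :: "('g::group_add \<Rightarrow> 'x \<Rightarrow> 'x) \<Rightarrow> bool" where
  "is_action act \<longleftrightarrow> (\<forall>x. act 0 x = x) \<and> (\<forall>g h x. act (g + h) x = act g (act h x))"

definition continuous_action ::
    "('g::topological_group_add \<Rightarrow> 'x \<Rightarrow> 'x) \<Rightarrow> 'x topology \<Rightarrow> bool" where
  "continuous_action act \<tau> \<longleftrightarrow>
     continuous_map (prod_topology euclidean \<tau>) \<tau> (\<lambda>(g, x). act g x)"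

definition polish_G_space ::
    "('g::topological_group_add \<Rightarrow> 'x \<Rightarrow> 'x) \<Rightarrow> 'x topology \<Rightarrow> bool" where
  "polish_G_space act \<tau> \<longleftrightarrow> polish_topology \<tau> \<and> is_action act \<and> continuous_action act \<tau>"

definition graded_invariant ::
    "('g \<Rightarrow> 'x \<Rightarrow> 'x) \<Rightarrow> ('g \<Rightarrow> real) \<Rightarrow> ('x \<Rightarrow> real) \<Rightarrow> bool" where
  "graded_invariant act H \<phi> \<longleftrightarrow> (\<forall>g x. \<phi> (act g x) \<le> dotted_add (\<phi> x) (H g))"

section \<open>Category and Vaught transforms\<close>

definition nowhere_dense_in :: "'z topology \<Rightarrow> 'z set \<Rightarrow> bool" where
  "nowhere_dense_in T A \<longleftrightarrow> A \<subseteq> topspace T \<and> T interior_of (T closure_of A) = {}"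

definition meagre_in :: "'z topology \<Rightarrow> 'z set \<Rightarrow> bool" where
  "meagre_in T A \<longleftrightarrow> (\<exists>\<N>. countable \<N> \<and> (\<forall>N\<in>\<N>. nowhere_dense_in T N) \<and> A = \<Union>\<N>)"

definition comeagre_in :: "'z topology \<Rightarrow> 'z set \<Rightarrow> bool" where
  "comeagre_in T A \<longleftrightarrow> A \<subseteq> topspace T \<and> meagre_in T (topspace T - A)"

(* A is (co)meagre in the set S: the trace of A on S is (co)meagre in the subspace S. *)
definition meagre_in_set :: "'z::topological_space set \<Rightarrow> 'z set \<Rightarrow> bool" where
  "meagre_in_set S A \<longleftrightarrow> meagre_in (top_of_set S) (S \<inter> A)"

definition comeagre_in_set :: "'z::topological_space set \<Rightarrow> 'z set \<Rightarrow> bool" where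
  "comeagre_in_set S A \<longleftrightarrow> comeagre_in (top_of_set S) (S \<inter> A)"

(* Infima and suprema of grades are taken in [0,1]. Inserting the greatest element 1
   (resp. the least element 0) only matters when the set is empty, as Inf and Sup of the
   empty set of reals are unspecified. *)
definition vaught_delta ::
    "('g::topological_space \<Rightarrow> 'x \<Rightarrow> 'x) \<Rightarrow> ('g \<Rightarrow> real) \<Rightarrow> ('x \<Rightarrow> real) \<Rightarrow> 'x \<Rightarrow> real" where
  "vaught_delta act J \<phi> x =
     Inf (insert 1 {dotted_add r s |r s. r \<in> {0..1} \<and> s \<in> {0..1} \<and>
            \<not> meagre_in_set (sub_less J s) {h. \<phi> (act h x) < r}})"

definition vaught_star ::
    "('g::topological_space \<Rightarrow> 'x \<Rightarrow> 'x) \<Rightarrow> ('g \<Rightarrow> real) \<Rightarrow> ('x \<Rightarrow> real) \<Rightarrow> 'x \<Rightarrow> real" where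
  "vaught_star act J \<phi> x =
     Sup (insert 0 {dotted_diff r s |r s. r \<in> {0..1} \<and> s \<in> {0..1} \<and>
            \<not> comeagre_in_set (sub_less J s) {h. \<phi> (act h x) \<le> r}})"

section \<open>Nice bases and nice topologies\<close>

definition nice_basis ::
    "('g::topological_group_add \<Rightarrow> 'x \<Rightarrow> 'x) \<Rightarrow> 'x topology \<Rightarrow> ('g \<Rightarrow> real) set
       \<Rightarrow> ('x \<Rightarrow> real) set \<Rightarrow> bool" where
  "nice_basis act \<tau> \<R> \<B> \<longleftrightarrow>
     (\<forall>\<phi>\<in>\<B>. borel_graded_subset \<tau> \<phi>) \<and>
     countable \<B> \<and> finer_topology (graded_generated_topology \<B>) \<tau> \<and>
     (\<forall>\<phi>\<^sub>1\<in>\<B>. \<forall>\<phi>\<^sub>2\<in>\<B>.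
        (\<lambda>x. 1 - \<phi>\<^sub>1 x) \<in> \<B> \<and>
        (\<lambda>x. min (\<phi>\<^sub>1 x) (\<phi>\<^sub>2 x)) \<in> \<B> \<and>
        (\<lambda>x. max (\<phi>\<^sub>1 x) (\<phi>\<^sub>2 x)) \<in> \<B> \<and>
        (\<lambda>x. \<bar>\<phi>\<^sub>1 x - \<phi>\<^sub>2 x\<bar>) \<in> \<B> \<and>
        (\<lambda>x. dotted_diff (\<phi>\<^sub>1 x) (\<phi>\<^sub>2 x)) \<in> \<B> \<and>
        (\<lambda>x. dotted_add (\<phi>\<^sub>1 x) (\<phi>\<^sub>2 x)) \<in> \<B>) \<and>
     (\<forall>\<phi>\<in>\<B>. \<forall>q\<in>\<rat>. 0 < q \<longrightarrow> dotted_scale q \<phi> \<in> \<B>) \<and>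
     (\<forall>\<phi>\<in>\<B>. \<forall>\<rho>\<in>\<R>. vaught_star act \<rho> \<phi> \<in> \<B> \<and> vaught_delta act \<rho> \<phi> \<in> \<B>) \<and>
     (\<forall>\<phi>\<in>\<B>. \<exists>H\<in>\<R>. graded_subgroup H \<and> open_graded_subset euclidean H \<and>
        graded_invariant act H \<phi>)"

definition nice_topology ::
    "('g::topological_group_add \<Rightarrow> 'x \<Rightarrow> 'x) \<Rightarrow> 'x topology \<Rightarrow> ('g \<Rightarrow> real) set
       \<Rightarrow> 'x topology \<Rightarrow> bool" where
  "nice_topology act \<tau> \<R> t \<longleftrightarrow>
     polish_topology t \<and> finer_topology t \<tau> \<and> continuous_action act t \<and>
     (\<exists>\<B>. graded_basis t \<B> \<and> nice_basis act \<tau> \<R> \<B>)"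

end

theory Submission
  imports Defs
begin

text \<open>
  Close \<open>\<F>\<close> to a countable family \<open>A\<close> of Borel graded sets that is stable under all operations and
  generates a Polish topology \<open>t(A)\<close>; the members of \<open>A\<close> need not be invariant. The nice basis \<open>B\<close> consists of
  the members of \<open>A\<close> that are invariant under some graded subgroup in \<open>\<R>\<close>. It contains all transforms
  \<open>\<phi>\<^sup>\<Delta>\<^sup>\<rho>\<close> of members of \<open>A\<close>, because for \<open>\<rho> = Hg\<close> they are invariant under the conjugate \<open>H\<^sup>g\<close>. Hence, for
  \<open>V\<close> open in \<open>t(A)\<close> and \<open>U\<close> open in \<open>G\<close>, the set of all \<open>x\<close> such that \<open>g x \<in> V\<close> for non-meagrely many
  \<open>g \<in> U\<close> is open in \<open>t(B)\<close>. This yields continuity of the action for \<open>t(B)\<close>, and then complete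
  metrizability of \<open>t(B)\<close>: inside \<open>\<real>\<^sup>\<nat>\<close> the space is a \<open>G\<^sub>\<delta>\<close> set, described by refining these open sets
  indefinitely.
\<close>

section \<open>Meagre sets\<close>

text \<open>The two topologies have complementary defects. Making a Borel function continuous while
  staying Polish forces indicators of Borel sets into the family, and nothing makes these invariant;
  so \<open>t(A)\<close> is complete, but the action may fail to be continuous for it. In
  \<open>t(B)\<close> invariance controls how each function changes along an orbit, but completeness
  is no longer automatic once functions are discarded. The transforms bridge the gap: a point lies
  in a transform only if some group element carries it into the given \<open>t(A)\<close>-open set.
  Completeness of \<open>t(A)\<close> is therefore applied to translates of points instead of the
  points themselves, and the action carries the limit back; hence continuity has to come before
  completeness. Closure of \<open>\<R>\<close> under multiples and maxima keeps \<open>B\<close>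
  closed under the connectives: rational multiples of a subgroup absorb scaling, and a doubled
  maximum absorbs truncated differences.\<close>

lemma nowhere_dense_in_subset:
  assumes "nowhere_dense_in T A" "B \<subseteq> A"
  shows "nowhere_dense_in T B"
proof -
  have "T interior_of (T closure_of B) \<subseteq> T interior_of (T closure_of A)"
    by (intro interior_of_mono closure_of_mono assms(2))
  then show ?thesis using assms unfolding nowhere_dense_in_def by auto
qed

lemma meagre_in_subset:
  assumes "meagre_in T A" "B \<subseteq> A"
  shows "meagre_in T B"
proof -
  obtain \<N> where N: "countable \<N>" "\<And>N. N \<in> \<N> \<Longrightarrow> nowhere_dense_in T N" "A = \<Union>\<N>"
    using assms(1) unfolding meagre_in_def by blast
  have "B = \<Union>((\<lambda>N. N \<inter> B) ` \<N>)" using N(3) assms(2) by blast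
  moreover have "\<forall>N\<in>(\<lambda>N. N \<inter> B) ` \<N>. nowhere_dense_in T N"
    using N(2) nowhere_dense_in_subset by (metis (no_types, lifting) imageE inf_le1)
  ultimately show ?thesis unfolding meagre_in_def using N(1) by blast
qed

lemma meagre_in_Union:
  assumes "countable \<C>" "\<And>A. A \<in> \<C> \<Longrightarrow> meagre_in T A"
  shows "meagre_in T (\<Union>\<C>)"
proof -
  have "\<forall>A\<in>\<C>. \<exists>\<N>. countable \<N> \<and> (\<forall>N\<in>\<N>. nowhere_dense_in T N) \<and> \<Union>\<N> = A"
    using assms(2) unfolding meagre_in_def by blast
  then obtain \<N> where "\<forall>A\<in>\<C>. countable (\<N> A) \<and> (\<forall>N\<in>\<N> A. nowhere_dense_in T N) \<and> \<Union>(\<N> A) = A"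
    using bchoice[of \<C> "\<lambda>A \<N>. countable \<N> \<and> (\<forall>N\<in>\<N>. nowhere_dense_in T N) \<and> \<Union>\<N> = A"] by blast
  then have cN: "\<And>A. A \<in> \<C> \<Longrightarrow> countable (\<N> A)"
    and N: "\<And>A. A \<in> \<C> \<Longrightarrow> \<forall>N\<in>\<N> A. nowhere_dense_in T N"
    and U: "\<And>A. A \<in> \<C> \<Longrightarrow> \<Union>(\<N> A) = A" by auto
  have "\<Union>(\<Union>A\<in>\<C>. \<N> A) = (\<Union>A\<in>\<C>. \<Union>(\<N> A))" by blast
  then have "\<Union>\<C> = \<Union>(\<Union>A\<in>\<C>. \<N> A)" using U by simp
  moreover have "countable (\<Union>A\<in>\<C>. \<N> A)" using cN assms(1) by (intro countable_UN)
  moreover have "\<forall>N\<in>(\<Union>A\<in>\<C>. \<N> A). nowhere_dense_in T N" using N by blast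
  ultimately show ?thesis unfolding meagre_in_def by (intro exI[of _ "\<Union>A\<in>\<C>. \<N> A"] conjI)
qed

lemma nowhere_dense_in_imp_meagre_in: "nowhere_dense_in T A \<Longrightarrow> meagre_in T A"
  unfolding meagre_in_def by (rule exI[of _ "{A}"]) simp

lemma meagre_in_empty: "meagre_in T {}"
  by (rule nowhere_dense_in_imp_meagre_in) (simp add: nowhere_dense_in_def)

lemma meagre_in_Un: "meagre_in T A \<Longrightarrow> meagre_in T B \<Longrightarrow> meagre_in T (A \<union> B)"
  using meagre_in_Union[of "{A, B}" T] by auto

text \<open>An open set inside the closure of A meets A, hence S; conversely a relatively open
  subset of the open set S is open. The transforms are defined by category in subspaces, and this
  moves all category arguments to the whole group.\<close>

lemma nowhere_dense_in_open_subspace: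
  assumes "open S" "A \<subseteq> S"
  shows "nowhere_dense_in (top_of_set S) A \<longleftrightarrow> nowhere_dense_in euclidean A"
proof
  assume L: "nowhere_dense_in (top_of_set S) A"
  show "nowhere_dense_in euclidean A"
  proof (rule ccontr)
    assume "\<not> ?thesis"
    then have ne: "interior (closure A) \<noteq> {}" by (simp add: nowhere_dense_in_def)
    let ?O = "interior (closure A)"
    have "?O \<inter> A \<noteq> {}"
      using ne interior_subset[of "closure A"] by (metis inf.orderE open_Int_closure_eq_empty open_interior)
    then have "?O \<inter> S \<noteq> {}" using assms by blast
    moreover have "openin (top_of_set S) (?O \<inter> S)"
      by (simp add: Int_commute openin_open_Int)
    moreover have "?O \<inter> S \<subseteq> top_of_set S closure_of A"
      using interior_subset[of "closure A"] assms(2) by (auto simp: closure_of_subtopology Int_absorb1)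
    ultimately have "top_of_set S interior_of (top_of_set S closure_of A) \<noteq> {}"
      by (metis interior_of_maximal subset_empty)
    then show False using L by (simp add: nowhere_dense_in_def)
  qed
next
  assume R: "nowhere_dense_in euclidean A"
  have "top_of_set S interior_of (top_of_set S closure_of A) = {}"
  proof -
    let ?O = "top_of_set S interior_of (top_of_set S closure_of A)"
    have "open ?O" using assms(1) openin_open_eq by (metis openin_interior_of)
    moreover have "?O \<subseteq> closure A"
      using interior_of_subset[of "top_of_set S" "top_of_set S closure_of A"]
      by (auto simp: closure_of_subtopology Int_absorb1 assms(2))
    ultimately have "?O \<subseteq> interior (closure A)" by (simp add: interior_maximal)
    then show ?thesis using R by (simp add: nowhere_dense_in_def)
  qed
  then show "nowhere_dense_in (top_of_set S) A" using assms(2) by (simp add: nowhere_dense_in_def)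
qed

lemma meagre_in_open_subspace:
  assumes "open S" "A \<subseteq> S"
  shows "meagre_in (top_of_set S) A \<longleftrightarrow> meagre_in euclidean A"
proof -
  have "(\<forall>N\<in>\<N>. nowhere_dense_in (top_of_set S) N) \<longleftrightarrow> (\<forall>N\<in>\<N>. nowhere_dense_in euclidean N)"
    if "A = \<Union>\<N>" for \<N>
    using nowhere_dense_in_open_subspace[OF assms(1)] assms(2) that by blast
  then show ?thesis unfolding meagre_in_def by blast
qed

lemma meagre_in_set_open:
  assumes "open S"
  shows "meagre_in_set S A \<longleftrightarrow> meagre_in euclidean (S \<inter> A)"
  unfolding meagre_in_set_def using assms by (simp add: meagre_in_open_subspace)

lemma Baire_nonmeagre:
  fixes U :: "'a::complete_space set"
  assumes "open U" "meagre_in euclidean U"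
  shows "U = {}"
proof -
  obtain \<N> where N: "countable \<N>" "\<And>N. N \<in> \<N> \<Longrightarrow> nowhere_dense_in euclidean N" "U = \<Union>\<N>"
    using assms(2) unfolding meagre_in_def by blast
  have "euclidean interior_of \<Union>(closure ` \<N>) = {}"
    using N by (intro Baire_category_alt)
      (auto simp: completely_metrizable_space_euclidean nowhere_dense_in_def)
  moreover have "U \<subseteq> \<Union>(closure ` \<N>)" using N(3) closure_subset by blast
  ultimately show ?thesis using assms(1) interior_maximal by (metis euclidean_interior_of subset_empty)
qed

lemma meagre_in_homeomorphic_image:
  assumes h: "homeomorphic_map X Y f" and A: "meagre_in X A"
  shows "meagre_in Y (f ` A)"
proof -
  obtain \<N> where N: "countable \<N>" "\<And>N. N \<in> \<N> \<Longrightarrow> nowhere_dense_in X N" "A = \<Union>\<N>"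
    using A unfolding meagre_in_def by blast
  have "nowhere_dense_in Y (f ` N)" if "N \<in> \<N>" for N
  proof -
    have sub: "N \<subseteq> topspace X" and e: "X interior_of (X closure_of N) = {}"
      using N(2)[OF that] by (auto simp: nowhere_dense_in_def)
    have "Y interior_of (Y closure_of (f ` N)) = f ` (X interior_of (X closure_of N))"
      using homeomorphic_map_interior_of[OF h closure_of_subset_topspace]
        homeomorphic_map_closure_of[OF h sub] by simp
    moreover have "f ` N \<subseteq> topspace Y"
      using h sub homeomorphic_imp_surjective_map by blast
    ultimately show ?thesis using e by (simp add: nowhere_dense_in_def)
  qed
  moreover have "f ` A = \<Union>((`) f ` \<N>)" using N(3) by blast
  ultimately show ?thesis unfolding meagre_in_def
    using N(1) by (intro exI[of _ "(`) f ` \<N>"]) auto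
qed

lemma meagre_in_translate:
  fixes A :: "'g::topological_group_add set"
  shows "meagre_in euclidean ((\<lambda>h. h + k) -` A) \<longleftrightarrow> meagre_in euclidean A"
proof -
  have c: "continuous_on UNIV (\<lambda>h. h + k)" for k :: 'g by (intro continuous_intros)
  have "homeomorphic_maps euclidean euclidean (\<lambda>h. h + k) (\<lambda>h. h + - k)" for k :: 'g
    using c[of k] c[of "-k"] by (simp add: homeomorphic_maps_def add.assoc)
  then have hom: "homeomorphic_map euclidean euclidean (\<lambda>h. h + k)" for k :: 'g
    using homeomorphic_maps_map by blast
  have 2: "(\<lambda>h. h + - k) ` A = (\<lambda>h. h + k) -` A"
  proof
    show "(\<lambda>h. h + k) -` A \<subseteq> (\<lambda>h. h + - k) ` A"
    proof
      fix h assume "h \<in> (\<lambda>h. h + k) -` A"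
      then have "h + k \<in> A" "h = (h + k) + - k" by (auto simp: add.assoc)
      then show "h \<in> (\<lambda>h. h + - k) ` A" by (rule rev_image_eqI)
    qed
  qed (auto simp: add.assoc)
  have 1: "(\<lambda>h. h + k) ` ((\<lambda>h. h + k) -` A) = A"
    unfolding 2[symmetric] by (simp add: image_image add.assoc)
  show ?thesis
    using meagre_in_homeomorphic_image[OF hom[of k], of "(\<lambda>h. h + k) -` A"]
      meagre_in_homeomorphic_image[OF hom[of "-k"], of A] unfolding 1 2 by blast
qed

section \<open>Polish topologies as pullbacks\<close>

lemma gdelta_in_vimage:
  assumes "continuous_map X Y f" "topspace X = UNIV" "gdelta_in Y S"
  shows "gdelta_in X (f -` S)"
proof -
  obtain C where C: "\<And>n::nat. openin Y (C n)" "\<Inter>(range C) = S"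
    using assms(3) unfolding gdelta_in_descending by blast
  have "openin X (f -` C n)" for n
    using openin_continuous_map_preimage[OF assms(1) C(1)[of n]] assms(2)
    by (simp add: vimage_def)
  then have "gdelta_in X (\<Inter>((\<lambda>n. f -` C n) ` UNIV))"
    by (intro gdelta_in_Inter) (auto simp: open_imp_gdelta_in)
  moreover have "f -` S = \<Inter>((\<lambda>n. f -` C n) ` UNIV)" using C(2) by auto
  ultimately show ?thesis by simp
qed

text \<open>Alexandrov's theorem: \<open>pb\<close> and injectivity make \<open>f\<close> a
  homeomorphism onto a G-delta subspace. It is applied to the graph of a sequence of functions, and
  later to the evaluation map into the space of real sequences.\<close>

lemma completely_metrizable_space_pullback:
  assumes Y: "completely_metrizable_space Y" and inj: "inj f" and gd: "gdelta_in Y (range f)"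
    and pb: "\<And>U. openin t U \<longleftrightarrow> (\<exists>V. openin Y V \<and> U = f -` V)" and top: "topspace t = UNIV"
  shows "completely_metrizable_space t"
proof -
  let ?Z = "subtopology Y (range f)"
  have sub: "range f \<subseteq> topspace Y" using gd gdelta_in_subset by blast
  have "homeomorphic_map t ?Z f"
    unfolding homeomorphic_eq_everything_map
  proof (intro conjI)
    have "continuous_map t Y f"
      unfolding continuous_map
    proof (intro conjI allI impI)
      fix U assume "openin Y U"
      then show "openin t {x \<in> topspace t. f x \<in> U}" using pb top by (auto simp: vimage_def)
    qed (use sub top in auto)
    then show "continuous_map t ?Z f" by (simp add: continuous_map_in_subtopology)
    show "open_map t ?Z f"
      unfolding open_map_def
    proof (intro allI impI)
      fix U assume "openin t U"
      then obtain V where V: "openin Y V" "U = f -` V" unfolding pb by blast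
      then have "f ` U = V \<inter> range f" by auto
      then show "openin ?Z (f ` U)" unfolding openin_subtopology using V(1) by (intro exI[of _ V]) simp
    qed
    show "closed_map t ?Z f"
      unfolding closed_map_def
    proof (intro allI impI)
      fix U assume "closedin t U"
      then have "openin t (- U)" using top by (simp add: closedin_def Compl_eq_Diff_UNIV)
      then obtain V where V: "openin Y V" "- U = f -` V" unfolding pb by blast
      then have "x \<in> U \<longleftrightarrow> f x \<notin> V" for x by blast
      then have "f ` U = (topspace Y - V) \<inter> range f" using sub by (auto simp: image_iff)
      then show "closedin ?Z (f ` U)" using V(1) by (auto simp: closedin_subtopology)
    qed
    show "f ` topspace t = topspace ?Z" using top sub by auto
    show "inj_on f (topspace t)" using inj top by simp
  qed
  then have "t homeomorphic_space ?Z" using homeomorphic_map_imp_homeomorphic_space by blast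
  then show ?thesis
    using completely_metrizable_space_gdelta_in[OF Y gd] homeomorphic_completely_metrizable_space by blast
qed

text \<open>The preimages of open sets already form a topology, so it is enough to look at a
  subbasis.\<close>

lemma openin_pullback_of_subbasis:
  assumes "openin (topology_generated_by \<S>) U"
    and "\<And>S. S \<in> \<S> \<Longrightarrow> \<exists>V. openin Y V \<and> S = f -` V"
  shows "\<exists>V. openin Y V \<and> U = f -` V"
  using generate_topology_on_coarsest[of "openin (pullback_topology UNIV f Y)" \<S> U] assms
  by (auto simp: openin_pullback_topology openin_topology_generated_by_iff istopology_openin)

section \<open>Countable families of Borel functions and Polish topologies\<close>

text \<open>The graph of a sequence of functions. Keeping x as a coordinate makes the map injective
  and places its range in a completely metrizable product.\<close>

definition joint_map :: "(nat \<Rightarrow> 'x \<Rightarrow> real) \<Rightarrow> 'x \<Rightarrow> 'x \<times> (nat \<Rightarrow> real)" where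
  "joint_map f x = (x, \<lambda>n. f n x)"

text \<open>The condition is put on the graph and not on the generated topology: graphs can be
  intersected, so it passes to countable joins, and \<open>resolved_completely_metrizable\<close>
  recovers the topology afterwards.\<close>

definition resolved :: "'x topology \<Rightarrow> (nat \<Rightarrow> 'x \<Rightarrow> real) \<Rightarrow> bool" where
  "resolved \<tau> f \<longleftrightarrow> (\<forall>n. borel_graded_subset \<tau> (f n)) \<and>
     gdelta_in (prod_topology \<tau> euclidean) (range (joint_map f))"

definition join :: "(nat \<Rightarrow> nat \<Rightarrow> 'a) \<Rightarrow> nat \<Rightarrow> 'a" where
  "join f m = f (fst (prod_decode m)) (snd (prod_decode m))"

lemma join_encode [simp]: "join f (prod_encode (k, n)) = f k n"
  by (simp add: join_def)

lemma range_join: "range (join f) = (\<Union>k. range (f k))"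
proof -
  have "f k n \<in> range (join f)" for k n
    by (rule range_eqI[of _ _ "prod_encode (k, n)"]) simp
  then show ?thesis by (auto simp: join_def)
qed

text \<open>The ambiguous class of sets that are both G-delta and F-sigma. In
  \<open>resolved_insert\<close> the condition \<open>P q\<close> occurs once positively and once
  negated, and both occurrences must be G-delta.\<close>

definition gdelta_fsigma_in :: "'z topology \<Rightarrow> 'z set \<Rightarrow> bool" where
  "gdelta_fsigma_in X P \<longleftrightarrow> gdelta_in X P \<and> gdelta_in X (- P)"

lemma gdelta_fsigma_in_vimage:
  assumes "continuous_map X Y f" "topspace X = UNIV" "gdelta_fsigma_in Y S"
  shows "gdelta_fsigma_in X (f -` S)"
  using gdelta_in_vimage[OF assms(1,2)] assms(3) unfolding gdelta_fsigma_in_def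
  by (metis vimage_Compl)

lemma gdelta_fsigma_in_open:
  assumes "metrizable_space X" "topspace X = UNIV" "openin X U"
  shows "gdelta_fsigma_in X U"
proof -
  have "closedin X (- U)" using assms by (simp add: closedin_def Compl_eq_Diff_UNIV Diff_Diff_Int)
  then show ?thesis
    using assms by (simp add: gdelta_fsigma_in_def open_imp_gdelta_in closed_imp_gdelta_in)
qed

lemma gdelta_fsigma_in_Compl: "gdelta_fsigma_in X U \<Longrightarrow> gdelta_fsigma_in X (- U)"
  unfolding gdelta_fsigma_in_def by simp

lemma gdelta_fsigma_in_indicator:
  assumes "metrizable_space X" "topspace X = UNIV" "openin X U"
  shows "gdelta_fsigma_in X {x. indicator U x < (q::real)}"
proof -
  have o: "gdelta_fsigma_in X UNIV"
    using gdelta_fsigma_in_open[OF assms(1,2) openin_topspace] assms(2) by simp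
  have "{x. indicator U x < q} = (if q \<le> 0 then - UNIV else if q \<le> 1 then - U else UNIV)"
    by (auto simp: indicator_def)
  then show ?thesis
    using o gdelta_fsigma_in_open[OF assms] gdelta_fsigma_in_Compl by (smt (verit))
qed

lemma continuous_map_reindex:
  "continuous_map (prod_topology \<tau> euclidean) (prod_topology \<tau> euclidean)
     (\<lambda>p. (fst p, \<lambda>n::nat. (snd p (g n :: nat) :: real)))"
proof -
  have "continuous_on UNIV (\<lambda>\<epsilon>::nat \<Rightarrow> real. \<lambda>n. \<epsilon> (g n))"
    by (intro continuous_on_coordinatewise_then_product continuous_on_product_coordinates)
  then have "continuous_map euclidean euclidean (\<lambda>\<epsilon>::nat \<Rightarrow> real. \<lambda>n. \<epsilon> (g n))"
    by simp
  from continuous_map_compose[OF continuous_map_snd this]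
  show ?thesis by (simp add: continuous_map_paired continuous_map_fst o_def)
qed

lemma continuous_map_coordinate:
  "continuous_map (prod_topology \<tau> euclidean) euclideanreal (\<lambda>p. snd p (n::nat))"
proof -
  have "continuous_map euclidean euclideanreal (\<lambda>\<epsilon>::nat \<Rightarrow> real. \<epsilon> n)"
    by simp
  from continuous_map_compose[OF continuous_map_snd this] show ?thesis by (simp add: o_def)
qed

lemma openin_coordinate:
  assumes "topspace \<tau> = UNIV" "open S"
  shows "openin (prod_topology \<tau> euclidean) {p. (snd p (n::nat) :: real) \<in> S}"
  using openin_continuous_map_preimage[OF continuous_map_coordinate[of \<tau> n], of S] assms by simp

lemma graded_generated_openin: "\<phi> \<in> A \<Longrightarrow> openin (graded_generated_topology A) (sub_less \<phi> r)"
  unfolding graded_generated_topology_def by (rule topology_generated_by_Basis) blast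

lemma graded_generated_topspace [simp]: "topspace (graded_generated_topology A) = UNIV"
  by (simp add: graded_generated_topology_def)

text \<open>Openness of a graded subset is only upper semicontinuity; the complement supplies the
  lower half.\<close>

lemma continuous_map_graded_generated:
  assumes "\<phi> \<in> A" "(\<lambda>x. 1 - \<phi> x) \<in> A"
  shows "continuous_map (graded_generated_topology A) euclideanreal \<phi>"
proof -
  have "{x. \<phi> x > r} = sub_less (\<lambda>x. 1 - \<phi> x) (1 - r)" for r by (auto simp: sub_less_def)
  moreover have "{x. \<phi> x < r} = sub_less \<phi> r" for r by (simp add: sub_less_def)
  ultimately show ?thesis
    unfolding continuous_map_upper_lower_semicontinuous_lt
    using graded_generated_openin[OF assms(1)] graded_generated_openin[OF assms(2)] by simp
qed

context
  fixes \<tau> :: "'x topology"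
  assumes polish: "polish_topology \<tau>"
begin

private abbreviation Y :: "('x \<times> (nat \<Rightarrow> real)) topology" where
  "Y \<equiv> prod_topology \<tau> euclidean"

lemma polish_topspace: "topspace \<tau> = UNIV"
  using polish by (simp add: polish_topology_def)

private lemma Y_topspace: "topspace Y = UNIV"
  by (simp add: polish_topspace)

private lemma Y_complete: "completely_metrizable_space Y"
  using polish completely_metrizable_space_euclidean[where 'a = "nat \<Rightarrow> real"]
  by (simp add: completely_metrizable_space_prod_topology polish_topology_def)

private lemma tau_metrizable: "metrizable_space \<tau>"
  using polish by (simp add: polish_topology_def completely_metrizable_imp_metrizable_space)

text \<open>A sequence of coordinates splits into countably many blocks, and a point lies on the
  joint graph iff each block lies on its own graph. The shared first coordinate forces all blocks to
  be evaluated at the same point.\<close>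

lemma resolved_join:
  assumes "\<And>k. resolved \<tau> (f k)"
  shows "resolved \<tau> (join f)"
proof -
  let ?R = "\<lambda>k p. (fst p, \<lambda>n. snd p (prod_encode (k, n)))"
  have "gdelta_in Y (\<Inter>((\<lambda>k. ?R k -` range (joint_map (f k))) ` UNIV))"
    using assms
    by (intro gdelta_in_Inter)
      (auto simp: resolved_def intro!: gdelta_in_vimage[OF continuous_map_reindex Y_topspace])
  moreover have "range (joint_map (join f)) = \<Inter>((\<lambda>k. ?R k -` range (joint_map (f k))) ` UNIV)"
  proof
    show "range (joint_map (join f)) \<subseteq> \<Inter>((\<lambda>k. ?R k -` range (joint_map (f k))) ` UNIV)"
      by (auto simp: joint_map_def)
    show "\<Inter>((\<lambda>k. ?R k -` range (joint_map (f k))) ` UNIV) \<subseteq> range (joint_map (join f))"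
    proof
      fix p assume p: "p \<in> \<Inter>((\<lambda>k. ?R k -` range (joint_map (f k))) ` UNIV)"
      have "snd p (prod_encode (k, n)) = f k n (fst p)" for k n
      proof -
        have "?R k p \<in> range (joint_map (f k))" using p by blast
        then obtain x where x: "?R k p = joint_map (f k) x" by blast
        then have "(\<lambda>n. snd p (prod_encode (k, n))) = (\<lambda>n. f k n x)" "fst p = x"
          by (auto simp: joint_map_def)
        then show ?thesis by metis
      qed
      from this[of "fst (prod_decode m)" "snd (prod_decode m)" for m]
      have "snd p m = join f m (fst p)" for m by (simp add: join_def)
      then have "p = joint_map (join f) (fst p)" by (simp add: joint_map_def prod_eq_iff fun_eq_iff)
      then show "p \<in> range (joint_map (join f))" by (rule range_eqI)
    qed
  qed
  ultimately show ?thesis using assms by (simp add: resolved_def join_def)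
qed

text \<open>The value \<open>v = \<psi> x\<close> is pinned down by \<open>v < q \<Longrightarrow> \<psi> x < q\<close> and \<open>\<psi> x < q \<Longrightarrow> v \<le> q\<close> for all
  rational \<open>q\<close>, which are \<open>G\<^sub>\<delta>\<close> conditions.\<close>

lemma resolved_insert:
  assumes f: "resolved \<tau> f" and \<psi>: "borel_graded_subset \<tau> \<psi>"
    and P: "\<And>q. q \<in> \<rat> \<Longrightarrow> gdelta_fsigma_in Y (P q)"
    and iff: "\<And>q x. q \<in> \<rat> \<Longrightarrow> \<psi> x < q \<longleftrightarrow> joint_map f x \<in> P q"
  shows "resolved \<tau> (case_nat \<psi> f)"
proof -
  let ?R = "\<lambda>p. (fst p, \<lambda>n. snd p (Suc n))"
  let ?C = "\<lambda>q. ((\<lambda>p. snd p 0) -` {q..} \<union> ?R -` P q) \<inter> ((\<lambda>p. snd p 0) -` {..q} \<union> ?R -` (- P q))"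
  let ?D = "?R -` range (joint_map f) \<inter> \<Inter>(?C ` \<rat>)"
  have g: "gdelta_in Y ((\<lambda>p. snd p 0) -` S)" if "closed S" for S :: "real set"
  proof (rule gdelta_in_vimage[OF continuous_map_coordinate Y_topspace])
    show "gdelta_in euclidean S" using that
      by (simp add: closed_imp_gdelta_in metrizable_space_euclidean)
  qed
  have R: "gdelta_in Y (?R -` S)" if "gdelta_in Y S" for S
    by (rule gdelta_in_vimage[OF continuous_map_reindex Y_topspace that])
  have "gdelta_in Y ?D"
  proof (intro gdelta_in_Int gdelta_in_Inter R)
    show "gdelta_in Y (range (joint_map f))" using f by (simp add: resolved_def)
    show "countable (?C ` \<rat>)" by (simp add: countable_rat)
    show "?C ` \<rat> \<noteq> {}" using Rats_0 by blast
    fix S assume "S \<in> ?C ` \<rat>"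
    then obtain q where "q \<in> \<rat>" "S = ?C q" by blast
    then show "gdelta_in Y S"
      using P[of q] unfolding gdelta_fsigma_in_def by (auto intro!: gdelta_in_Int gdelta_in_Un R g)
  qed
  moreover have "range (joint_map (case_nat \<psi> f)) = ?D"
  proof
    show "range (joint_map (case_nat \<psi> f)) \<subseteq> ?D"
      using iff[symmetric] by (auto simp: joint_map_def)
    show "?D \<subseteq> range (joint_map (case_nat \<psi> f))"
    proof
      fix p assume p: "p \<in> ?D"
      then have "?R p \<in> range (joint_map f)" "p \<in> \<Inter>(?C ` \<rat>)" by simp_all
      then obtain x where x: "?R p = joint_map f x" by (auto simp only: image_iff)
      have "snd p 0 = \<psi> x"
      proof (rule ccontr)
        assume "snd p 0 \<noteq> \<psi> x"
        then obtain q where q: "q \<in> \<rat>" "snd p 0 < q \<and> q < \<psi> x \<or> \<psi> x < q \<and> q < snd p 0"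
          using Rats_dense_in_real by (meson linorder_neqE_linordered_idom)
        then have "p \<in> ?C q" using \<open>p \<in> \<Inter>(?C ` \<rat>)\<close> by blast
        then have "(q \<le> snd p 0 \<or> \<psi> x < q) \<and> (snd p 0 \<le> q \<or> \<not> \<psi> x < q)"
          using iff[OF q(1), of x] x by simp
        then show False using q(2) by linarith
      qed
      moreover have "snd p (Suc n) = f n x" for n
        using x by (auto simp: joint_map_def fun_eq_iff)
      ultimately have "snd p = (\<lambda>n. case_nat \<psi> f n x)"
        by (auto simp: fun_eq_iff split: nat.split)
      then have "p = joint_map (case_nat \<psi> f) x" using x by (auto simp: joint_map_def prod_eq_iff)
      then show "p \<in> range (joint_map (case_nat \<psi> f))" by (rule range_eqI)
    qed
  qed
  ultimately show ?thesis using f \<psi> by (auto simp: resolved_def split: nat.split)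
qed

section \<open>Borel sets and Borel functions as members of resolved sequences\<close>

private lemma borel_graded_indicator:
  assumes "A \<in> sigma_sets UNIV {U. openin \<tau> U}"
  shows "borel_graded_subset \<tau> (indicator A)"
  using assms
  by (auto simp: borel_graded_subset_def graded_subset_def polish_topspace
      intro!: borel_measurable_indicator)

private lemma resolved_const: "resolved \<tau> (\<lambda>n (x::'x). 0)"
proof -
  have "range (joint_map (\<lambda>n (x::'x). 0)) = snd -` {\<lambda>n::nat. 0::real}"
    by (auto simp: joint_map_def)
  moreover have "gdelta_in Y (snd -` {\<lambda>n. 0})"
    by (rule gdelta_in_vimage[OF continuous_map_snd Y_topspace])
       (simp add: closed_imp_gdelta_in metrizable_space_euclidean)
  ultimately show ?thesis by (simp add: resolved_def borel_graded_subset_def graded_subset_def)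
qed

text \<open>The graph version of making a Borel set clopen in a finer Polish topology. Position 0 is
  prescribed so that the next induction step knows which coordinate carries the indicator.\<close>

lemma resolved_Borel_set:
  assumes "A \<in> sigma_sets UNIV {U. openin \<tau> U}"
  shows "\<exists>f. resolved \<tau> f \<and> f 0 = indicator A"
  using assms
proof induction
  case (Basic A)
  have "resolved \<tau> (case_nat (indicator A) (\<lambda>n x. 0))"
  proof (rule resolved_insert[OF resolved_const])
    show "borel_graded_subset \<tau> (indicator A)" using Basic by (intro borel_graded_indicator) auto
    show "gdelta_fsigma_in Y (fst -` {x. indicator A x < (q::real)})" for q
      using Basic tau_metrizable polish_topspace
      by (intro gdelta_fsigma_in_vimage[OF continuous_map_fst Y_topspace] gdelta_fsigma_in_indicator) auto
  qed (simp add: joint_map_def)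
  then show ?case by (intro exI[of _ "case_nat (indicator A) (\<lambda>n x. 0)"]) simp
next
  case Empty
  have "indicator {} = (\<lambda>x. 0 :: real)" by auto
  then show ?case using resolved_const by metis
next
  case (Compl A)
  then obtain f where f: "resolved \<tau> f" "f 0 = indicator A" by blast
  have "resolved \<tau> (case_nat (indicator (UNIV - A)) f)"
  proof (rule resolved_insert[OF f(1)])
    show "borel_graded_subset \<tau> (indicator (UNIV - A))"
      using Compl by (intro borel_graded_indicator sigma_sets.Compl)
    show "gdelta_fsigma_in Y ((\<lambda>p. snd p 0) -` {v. 1 - v < q})" for q
      by (intro gdelta_fsigma_in_vimage[OF continuous_map_coordinate Y_topspace] gdelta_fsigma_in_open)
        (auto simp: metrizable_space_euclidean intro!: open_Collect_less continuous_intros)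
  qed (auto simp: joint_map_def f(2) indicator_def)
  then show ?case by (intro exI[of _ "case_nat (indicator (UNIV - A)) f"]) simp
next
  case (Union A)
  then obtain f where f: "\<And>i. resolved \<tau> (f i)" "\<And>i. f i 0 = indicator (A i)" by metis
  \<comment> \<open>Coordinate \<open>prod_encode (i, 0)\<close> of the joined sequence is the
    indicator of \<open>A i\<close>, so with the threshold 1/2 membership in the union becomes an
    open condition on the coordinates.\<close>
  let ?E = "{\<epsilon>::nat \<Rightarrow> real. \<exists>i. 1/2 < \<epsilon> (prod_encode (i, 0))}"
  have "open ?E"
    by (intro open_Collect_ex open_Collect_less continuous_on_product_coordinates continuous_intros)
  have "resolved \<tau> (case_nat (indicator (\<Union>i. A i)) (join f))"
  proof (rule resolved_insert[OF resolved_join])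
    show "borel_graded_subset \<tau> (indicator (\<Union>i. A i))"
      using Union by (intro borel_graded_indicator sigma_sets.Union)
    show "gdelta_fsigma_in Y (snd -` {\<epsilon>. indicator ?E \<epsilon> < (q::real)})" for q
      using \<open>open ?E\<close>
      by (intro gdelta_fsigma_in_vimage[OF continuous_map_snd Y_topspace] gdelta_fsigma_in_indicator)
        (auto simp: metrizable_space_euclidean)
    show "(indicator (\<Union>i. A i) x < q) = (joint_map (join f) x \<in> snd -` {\<epsilon>. indicator ?E \<epsilon> < q})"
      for q x
    proof -
      have "(\<lambda>n. join f n x) \<in> ?E \<longleftrightarrow> x \<in> (\<Union>i. A i)"
        by (auto simp: f(2) indicator_def)
      then show ?thesis by (simp add: joint_map_def indicator_def)
    qed
  qed (rule f)
  then show ?case by (intro exI[of _ "case_nat (indicator (\<Union>i. A i)) (join f)"]) simp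
qed

text \<open>Relative to the indicators of its rational sublevel sets, every condition
  \<open>\<phi> x < q\<close> with rational q is an open condition on one coordinate.\<close>

lemma resolved_Borel_function:
  assumes \<phi>: "borel_graded_subset \<tau> \<phi>"
  shows "\<exists>f. resolved \<tau> f \<and> \<phi> \<in> range f"
proof -
  let ?M = "sigma UNIV {U. openin \<tau> U}"
  have "{x. \<phi> x < q} \<in> sigma_sets UNIV {U. openin \<tau> U}" for q
  proof -
    have "\<phi> \<in> borel_measurable ?M" using \<phi> by (simp add: borel_graded_subset_def polish_topspace)
    then have "\<phi> -` {..<q} \<inter> space ?M \<in> sets ?M" by (rule measurable_sets) simp
    then show ?thesis by (simp add: vimage_def)
  qed
  then have "\<forall>q. \<exists>f. resolved \<tau> f \<and> f 0 = indicator {x. \<phi> x < q}"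
    using resolved_Borel_set by blast
  then obtain f where f: "\<And>q. resolved \<tau> (f q)" "\<And>q. f q 0 = indicator {x. \<phi> x < q}" by metis
  \<comment> \<open>The position in \<open>?f\<close> of the indicator of the sublevel set at the
    rational q.\<close>
  let ?e = "\<lambda>q. prod_encode (to_nat_on (\<rat> :: real set) q, 0)"
  let ?f = "join (\<lambda>i. f (from_nat_into \<rat> i))"
  have "resolved \<tau> (case_nat \<phi> ?f)"
  proof (rule resolved_insert[OF resolved_join \<phi>])
    show "gdelta_fsigma_in Y ((\<lambda>p. snd p (?e q)) -` {1/2<..})" for q
      by (intro gdelta_fsigma_in_vimage[OF continuous_map_coordinate Y_topspace] gdelta_fsigma_in_open)
        (auto simp: metrizable_space_euclidean)
    fix q x assume "q \<in> (\<rat> :: real set)"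
    then have "from_nat_into \<rat> (to_nat_on \<rat> q) = q" by (simp add: countable_rat)
    then show "(\<phi> x < q) = (joint_map ?f x \<in> (\<lambda>p. snd p (?e q)) -` {1/2<..})"
      by (simp add: joint_map_def f(2) indicator_def)
  qed (rule f)
  moreover have "\<phi> \<in> range (case_nat \<phi> ?f)" by (rule range_eqI[of _ _ 0]) simp
  ultimately show ?thesis by blast
qed

lemma resolved_countable_family:
  assumes "countable C" "\<And>\<phi>. \<phi> \<in> C \<Longrightarrow> borel_graded_subset \<tau> \<phi>"
  shows "\<exists>f. resolved \<tau> f \<and> C \<subseteq> range f"
proof (cases "C = {}")
  case True
  then show ?thesis using resolved_const by blast
next
  case False
  have "\<forall>\<phi>\<in>C. \<exists>f. resolved \<tau> f \<and> \<phi> \<in> range f" using resolved_Borel_function assms(2) by blast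
  then obtain f where f: "\<And>\<phi>. \<phi> \<in> C \<Longrightarrow> resolved \<tau> (f \<phi>) \<and> \<phi> \<in> range (f \<phi>)" by metis
  let ?f = "\<lambda>i. f (from_nat_into C i)"
  have "resolved \<tau> (join ?f)" using f from_nat_into[OF False] by (intro resolved_join) blast
  moreover have "C \<subseteq> range (join ?f)"
  proof
    fix \<phi> assume "\<phi> \<in> C"
    moreover from this have "from_nat_into C (to_nat_on C \<phi>) = \<phi>" using assms(1) by simp
    ultimately have "\<phi> \<in> range (?f (to_nat_on C \<phi>))" using f by simp
    then show "\<phi> \<in> range (join ?f)" unfolding range_join by blast
  qed
  ultimately show ?thesis by blast
qed

text \<open>The generated topology is the one pulled back along the graph map: \<open>neg\<close>
  makes the function coordinates continuous, \<open>finer\<close> the identity coordinate, and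
  conversely subbasic sets are conditions on single coordinates.\<close>

lemma resolved_completely_metrizable:
  assumes f: "resolved \<tau> f" and neg: "\<And>\<phi>. \<phi> \<in> range f \<Longrightarrow> (\<lambda>x. 1 - \<phi> x) \<in> range f"
    and finer: "finer_topology (graded_generated_topology (range f)) \<tau>"
  shows "completely_metrizable_space (graded_generated_topology (range f))" (is "completely_metrizable_space ?t")
proof (rule completely_metrizable_space_pullback[OF Y_complete])
  show "inj (joint_map f)" by (auto simp: inj_def joint_map_def)
  show "gdelta_in Y (range (joint_map f))" using f by (simp add: resolved_def)
  have "continuous_map ?t \<tau> (\<lambda>x. x)"
    using finer polish_topspace by (simp add: continuous_map finer_topology_def)
  moreover have "continuous_map ?t (product_topology (\<lambda>_. euclideanreal) UNIV) (\<lambda>x n. f n x)"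
    unfolding continuous_map_componentwise_UNIV
    by (intro allI continuous_map_graded_generated rangeI neg)
  then have "continuous_map ?t euclidean (\<lambda>x n. f n x)" by (simp only: euclidean_product_topology)
  ultimately have "continuous_map ?t Y (\<lambda>x. (x, \<lambda>n. f n x))"
    by (simp add: continuous_map_paired)
  moreover have "joint_map f = (\<lambda>x. (x, \<lambda>n. f n x))" by (simp add: joint_map_def fun_eq_iff)
  ultimately have c: "continuous_map ?t Y (joint_map f)" by simp
  show "openin ?t U \<longleftrightarrow> (\<exists>V. openin Y V \<and> U = joint_map f -` V)" for U
  proof
    assume "openin ?t U"
    then show "\<exists>V. openin Y V \<and> U = joint_map f -` V"
      unfolding graded_generated_topology_def
    proof (rule openin_pullback_of_subbasis)
      fix S assume "S \<in> insert UNIV {sub_less \<phi> r |\<phi> r. \<phi> \<in> range f}"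
      then consider "S = UNIV" | n r where "S = sub_less (f n) r" by blast
      then show "\<exists>V. openin Y V \<and> S = joint_map f -` V"
      proof cases
        case 1
        then show ?thesis using openin_topspace[of Y] Y_topspace by (intro exI[of _ UNIV]) simp
      next
        case 2
        then show ?thesis using openin_coordinate[OF polish_topspace, of "{..<r}" n]
          by (intro exI[of _ "{p. snd p n \<in> {..<r}}"]) (auto simp: sub_less_def joint_map_def)
      qed
    qed
  next
    assume "\<exists>V. openin Y V \<and> U = joint_map f -` V"
    then show "openin ?t U"
      using openin_continuous_map_preimage[OF c] by (auto simp: vimage_def)
  qed
qed simp

end

section \<open>Vaught transforms\<close>

text \<open>The classical Vaught transform of V along U. Category is taken in the whole group, which
  for open U agrees with category in U by \<open>meagre_in_open_subspace\<close>.\<close>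

definition vaught_set :: "('g::topological_space \<Rightarrow> 'x \<Rightarrow> 'x) \<Rightarrow> 'g set \<Rightarrow> 'x set \<Rightarrow> 'x set" where
  "vaught_set act U V = {x. \<not> meagre_in euclidean (U \<inter> {h. act h x \<in> V})}"

lemma vaught_set_mono:
  assumes "U \<subseteq> U'" "V \<subseteq> V'"
  shows "vaught_set act U V \<subseteq> vaught_set act U' V'"
  using assms unfolding vaught_set_def by (auto elim!: contrapos_nn intro: meagre_in_subset)

text \<open>Meagre sets form a sigma-ideal, so non-meagreness of a countable union is witnessed by
  one piece. This is what reduces arbitrary open sets to basic ones, and to basic ones of small
  diameter.\<close>

lemma vaught_set_Union:
  assumes "countable \<U>" "countable \<V>"
  shows "vaught_set act (\<Union>\<U>) (\<Union>\<V>) = (\<Union>U\<in>\<U>. \<Union>V\<in>\<V>. vaught_set act U V)"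
proof
  show "vaught_set act (\<Union>\<U>) (\<Union>\<V>) \<subseteq> (\<Union>U\<in>\<U>. \<Union>V\<in>\<V>. vaught_set act U V)"
  proof
    fix x assume x: "x \<in> vaught_set act (\<Union>\<U>) (\<Union>\<V>)"
    show "x \<in> (\<Union>U\<in>\<U>. \<Union>V\<in>\<V>. vaught_set act U V)"
    proof (rule ccontr)
      assume "\<not> ?thesis"
      then have "meagre_in euclidean (\<Union>((\<lambda>(U, V). U \<inter> {h. act h x \<in> V}) ` (\<U> \<times> \<V>)))"
        using assms by (intro meagre_in_Union) (auto simp: vaught_set_def)
      moreover have "\<Union>\<U> \<inter> {h. act h x \<in> \<Union>\<V>} = \<Union>((\<lambda>(U, V). U \<inter> {h. act h x \<in> V}) ` (\<U> \<times> \<V>))"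
        by auto
      ultimately show False using x by (simp add: vaught_set_def)
    qed
  qed
  show "(\<Union>U\<in>\<U>. \<Union>V\<in>\<V>. vaught_set act U V) \<subseteq> vaught_set act (\<Union>\<U>) (\<Union>\<V>)"
    by (intro UN_least vaught_set_mono) auto
qed

lemma vaught_set_nonempty:
  assumes "x \<in> vaught_set act U V"
  obtains h where "h \<in> U" "act h x \<in> V"
proof -
  have "U \<inter> {h. act h x \<in> V} \<noteq> {}"
    using assms meagre_in_empty unfolding vaught_set_def by force
  then show thesis using that by auto
qed

lemma vaught_set_openI:
  fixes act :: "'g::complete_space \<Rightarrow> 'x \<Rightarrow> 'x"
  assumes "open O'" "h \<in> O'" "O' \<subseteq> U" "\<And>h. h \<in> O' \<Longrightarrow> act h x \<in> V"
  shows "x \<in> vaught_set act U V"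
proof -
  have "\<not> meagre_in euclidean O'" using Baire_nonmeagre assms(1,2) by blast
  moreover have "O' \<subseteq> U \<inter> {h. act h x \<in> V}" using assms by auto
  ultimately show ?thesis unfolding vaught_set_def using meagre_in_subset by blast
qed

text \<open>A set with the Baire property is comeagre in some basic open subset of every open set in which
  it is not meagre; in this form the Baire property passes to countable unions at once.\<close>

definition locally_comeagre :: "'g::topological_space set set \<Rightarrow> 'g set \<Rightarrow> bool" where
  "locally_comeagre \<G> B \<longleftrightarrow> (\<forall>U. open U \<and> \<not> meagre_in euclidean (U \<inter> B) \<longrightarrow>
     (\<exists>V\<in>\<G>. V \<noteq> {} \<and> V \<subseteq> U \<and> meagre_in euclidean (V - B)))"

lemma locally_comeagre_open:
  assumes "topological_basis \<G>" "open B"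
  shows "locally_comeagre \<G> B"
  unfolding locally_comeagre_def
proof (intro allI impI)
  fix U assume U: "open U \<and> \<not> meagre_in euclidean (U \<inter> B)"
  then have "U \<inter> B \<noteq> {}" using meagre_in_empty by metis
  then obtain h where "h \<in> U \<inter> B" by blast
  moreover have "open (U \<inter> B)" using U assms(2) by blast
  ultimately obtain V where V: "V \<in> \<G>" "h \<in> V" "V \<subseteq> U \<inter> B"
    using topological_basisE[OF assms(1)] by metis
  then have "V - B = {}" by blast
  then have "meagre_in euclidean (V - B)" by (simp only: meagre_in_empty)
  then show "\<exists>V\<in>\<G>. V \<noteq> {} \<and> V \<subseteq> U \<and> meagre_in euclidean (V - B)" using V by blast
qed

lemma locally_comeagre_UN:
  assumes "\<And>i::nat. locally_comeagre \<G> (B i)"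
  shows "locally_comeagre \<G> (\<Union>i. B i)"
  unfolding locally_comeagre_def
proof (intro allI impI)
  fix U assume U: "open U \<and> \<not> meagre_in euclidean (U \<inter> (\<Union>i. B i))"
  have "\<exists>i. \<not> meagre_in euclidean (U \<inter> B i)"
  proof (rule ccontr)
    assume "\<not> ?thesis"
    then have "meagre_in euclidean (U \<inter> B i)" for i by simp
    then have "meagre_in euclidean (\<Union>(range (\<lambda>i. U \<inter> B i)))"
      by (intro meagre_in_Union) (simp, elim imageE, simp)
    moreover have "U \<inter> (\<Union>i. B i) = \<Union>(range (\<lambda>i. U \<inter> B i))" by blast
    ultimately show False using U by argo
  qed
  then obtain i where "\<not> meagre_in euclidean (U \<inter> B i)" by blast
  then have "\<exists>V\<in>\<G>. V \<noteq> {} \<and> V \<subseteq> U \<and> meagre_in euclidean (V - B i)"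
    using assms[of i] U unfolding locally_comeagre_def by blast
  then obtain V where V: "V\<in>\<G>" "V \<noteq> {}" "V \<subseteq> U" "meagre_in euclidean (V - B i)" by blast
  have "V - (\<Union>i. B i) \<subseteq> V - B i" by blast
  then have "meagre_in euclidean (V - (\<Union>i. B i))" by (rule meagre_in_subset[OF V(4)])
  then show "\<exists>V\<in>\<G>. V \<noteq> {} \<and> V \<subseteq> U \<and> meagre_in euclidean (V - (\<Union>i. B i))"
    using V(1-3) by (intro bexI[of _ V] conjI)
qed

text \<open>Otherwise B would be non-meagre in every nonempty basic subset of U, so the basic sets
  in which B is comeagre would have a union dense in U. As there are only countably many of them, U
  - B would be meagre.\<close>

lemma locally_comeagre_Compl:
  assumes \<G>: "topological_basis \<G>" "countable \<G>" and B: "locally_comeagre \<G> B"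
  shows "locally_comeagre \<G> (- B)"
  unfolding locally_comeagre_def
proof (intro allI impI, rule ccontr)
  fix U assume U: "open U \<and> \<not> meagre_in euclidean (U \<inter> - B)"
    and neg: "\<not> (\<exists>V\<in>\<G>. V \<noteq> {} \<and> V \<subseteq> U \<and> meagre_in euclidean (V - - B))"
  define \<W> where "\<W> = {V\<in>\<G>. V \<noteq> {} \<and> V \<subseteq> U \<and> meagre_in euclidean (V - B)}"
  have "interior (closure (U - \<Union>\<W>)) = {}" (is "?I = {}")
  proof (rule ccontr)
    assume "?I \<noteq> {}"
    then have "?I \<inter> (U - \<Union>\<W>) \<noteq> {}"
      using interior_subset[of "closure (U - \<Union>\<W>)"]
      by (metis inf.orderE open_Int_closure_eq_empty open_interior)
    then obtain h where "h \<in> ?I \<inter> U" by blast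
    then obtain V where V: "V \<in> \<G>" "h \<in> V" "V \<subseteq> ?I \<inter> U"
      using topological_basisE[OF \<G>(1), of "?I \<inter> U" h] U by blast
    then have "\<not> meagre_in euclidean (V \<inter> B)" using neg by (auto simp: Diff_eq)
    moreover have "open V" using V(1) \<G>(1) topological_basis_open by blast
    ultimately obtain V' where V': "V' \<in> \<G>" "V' \<noteq> {}" "V' \<subseteq> V" "meagre_in euclidean (V' - B)"
      using B unfolding locally_comeagre_def by blast
    then have "V' \<in> \<W>" using V(3) unfolding \<W>_def by blast
    then have "V' \<inter> (U - \<Union>\<W>) = {}" by blast
    moreover have "open V'" using V'(1) \<G>(1) topological_basis_open by blast
    ultimately have "V' \<inter> closure (U - \<Union>\<W>) = {}" by (simp add: open_Int_closure_eq_empty)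
    then show False using V'(2,3) V(3) interior_subset[of "closure (U - \<Union>\<W>)"] by blast
  qed
  then have "meagre_in euclidean (U - \<Union>\<W>)"
    by (intro nowhere_dense_in_imp_meagre_in) (simp add: nowhere_dense_in_def)
  moreover have "meagre_in euclidean (\<Union>((\<lambda>V. V - B) ` \<W>))"
    using \<G>(2) unfolding \<W>_def by (intro meagre_in_Union) auto
  ultimately have "meagre_in euclidean ((U - \<Union>\<W>) \<union> \<Union>((\<lambda>V. V - B) ` \<W>))"
    by (rule meagre_in_Un)
  moreover have "U \<inter> - B \<subseteq> (U - \<Union>\<W>) \<union> \<Union>((\<lambda>V. V - B) ` \<W>)" by blast
  ultimately show False using U meagre_in_subset by blast
qed

section \<open>Borel measurability of the transform of a Borel set\<close>

lemma act_openin_point: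
  assumes "continuous_action act \<tau>" "topspace \<tau> = UNIV" "openin \<tau> V"
  shows "openin \<tau> {x. act h x \<in> V}"
proof -
  have "continuous_map \<tau> (prod_topology euclidean \<tau>) (\<lambda>x. (h, x))"
    by (simp add: continuous_map_paired)
  from continuous_map_compose[OF this] assms(1)
  have "continuous_map \<tau> \<tau> (\<lambda>x. act h x)" by (fastforce simp: continuous_action_def o_def)
  from openin_continuous_map_preimage[OF this assms(3)] show ?thesis using assms(2) by simp
qed

lemma act_openin_group:
  assumes "continuous_action act \<tau>" "topspace \<tau> = UNIV" "openin \<tau> V"
  shows "open {h. act h x \<in> V}"
proof -
  have "continuous_map euclidean (prod_topology euclidean \<tau>) (\<lambda>h. (h, x))"
    using assms(2) by (simp add: continuous_map_paired)
  from continuous_map_compose[OF this] assms(1)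
  have "continuous_map euclidean \<tau> (\<lambda>h. act h x)" by (fastforce simp: continuous_action_def o_def)
  from openin_continuous_map_preimage[OF this assms(3)] show ?thesis by simp
qed

text \<open>The induction carries two additions: all open U at once, because the complement case
  passes to smaller open sets, and the Baire property of the set of group elements carrying x into
  the Borel set, because that case needs it.\<close>

lemma vaught_set_Borel:
  fixes act :: "'g::{polish_space, topological_group_add} \<Rightarrow> 'x \<Rightarrow> 'x"
  assumes cont: "continuous_action act \<tau>" and top: "topspace \<tau> = UNIV"
    and A: "A \<in> sigma_sets UNIV {U. openin \<tau> U}" and U: "open U"
  shows "vaught_set act U A \<in> sigma_sets UNIV {U. openin \<tau> U}"
proof -
  let ?\<Sigma> = "sigma_sets UNIV {U. openin \<tau> U}"
  obtain \<G> :: "'g set set" where \<G>: "countable \<G>" "topological_basis \<G>"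
    using ex_countable_basis by blast
  have op: "open V" if "V \<in> \<G>" for V using that \<G>(2) topological_basis_open by blast
  from A have "(\<forall>x. locally_comeagre \<G> {h. act h x \<in> A}) \<and> (\<forall>U. open U \<longrightarrow> vaught_set act U A \<in> ?\<Sigma>)"
  proof induction
    case (Basic A)
    then have A: "openin \<tau> A" by simp
    have "vaught_set act U A = (\<Union>h\<in>U. {x. act h x \<in> A})" if "open U" for U
    proof
      show "vaught_set act U A \<subseteq> (\<Union>h\<in>U. {x. act h x \<in> A})"
        by (auto elim: vaught_set_nonempty)
      show "(\<Union>h\<in>U. {x. act h x \<in> A}) \<subseteq> vaught_set act U A"
      proof
        fix x assume "x \<in> (\<Union>h\<in>U. {x. act h x \<in> A})"
        then obtain h where "h \<in> U \<inter> {h. act h x \<in> A}" by blast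
        moreover have "open (U \<inter> {h. act h x \<in> A})"
          using that act_openin_group[OF cont top A] by blast
        ultimately show "x \<in> vaught_set act U A" by (intro vaught_set_openI) auto
      qed
    qed
    then have "openin \<tau> (vaught_set act U A)" if "open U" for U
      using that act_openin_point[OF cont top A] by auto
    then have "vaught_set act U A \<in> ?\<Sigma>" if "open U" for U
      using that by (intro sigma_sets.Basic) simp
    then show ?case
      using locally_comeagre_open[OF \<G>(2) act_openin_group[OF cont top A]] by blast
  next
    case Empty
    have "vaught_set act U {} = {}" for U by (simp add: vaught_set_def meagre_in_empty)
    then show ?case using \<G>(2) by (simp add: locally_comeagre_open sigma_sets.Empty)
  next
    case (Compl A)
    have lc: "locally_comeagre \<G> {h. act h x \<in> UNIV - A}" for x
      using locally_comeagre_Compl[OF \<G>(2,1), of "{h. act h x \<in> A}"] Compl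
      by (simp add: Compl_eq)
    have "vaught_set act U (UNIV - A) \<in> ?\<Sigma>" if U: "open U" for U
    proof -
      let ?\<W> = "{V\<in>\<G>. V \<noteq> {} \<and> V \<subseteq> U}"
      \<comment> \<open>By the Baire property, the complement of A is hit non-meagrely in U iff A is
        hit only meagrely in some nonempty basic V inside U; the backward direction is Baire's
        theorem for V.\<close>
      have "vaught_set act U (UNIV - A) = \<Union>((\<lambda>V. UNIV - vaught_set act V A) ` ?\<W>)"
      proof
        show "vaught_set act U (UNIV - A) \<subseteq> \<Union>((\<lambda>V. UNIV - vaught_set act V A) ` ?\<W>)"
        proof
          fix x assume "x \<in> vaught_set act U (UNIV - A)"
          then obtain V where V: "V \<in> ?\<W>" "meagre_in euclidean (V - {h. act h x \<in> UNIV - A})"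
            using lc[of x] U unfolding locally_comeagre_def vaught_set_def by blast
          moreover have "V - {h. act h x \<in> UNIV - A} = V \<inter> {h. act h x \<in> A}" by blast
          ultimately have "x \<in> UNIV - vaught_set act V A" by (simp add: vaught_set_def)
          then show "x \<in> \<Union>((\<lambda>V. UNIV - vaught_set act V A) ` ?\<W>)" using V(1) by blast
        qed
        show "\<Union>((\<lambda>V. UNIV - vaught_set act V A) ` ?\<W>) \<subseteq> vaught_set act U (UNIV - A)"
        proof
          fix x assume "x \<in> \<Union>((\<lambda>V. UNIV - vaught_set act V A) ` ?\<W>)"
          then obtain V where V: "V \<in> ?\<W>" "meagre_in euclidean (V \<inter> {h. act h x \<in> A})"
            by (auto simp: vaught_set_def)
          show "x \<in> vaught_set act U (UNIV - A)"
          proof (rule ccontr)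
            assume "x \<notin> vaught_set act U (UNIV - A)"
            then have "meagre_in euclidean ((V \<inter> {h. act h x \<in> A}) \<union> (U \<inter> {h. act h x \<in> UNIV - A}))"
              using V(2) by (auto simp: vaught_set_def intro: meagre_in_Un)
            moreover have "V \<subseteq> (V \<inter> {h. act h x \<in> A}) \<union> (U \<inter> {h. act h x \<in> UNIV - A})"
              using V(1) by blast
            ultimately have "meagre_in euclidean V" using meagre_in_subset by blast
            then show False using V(1) op Baire_nonmeagre by blast
          qed
        qed
      qed
      moreover have "countable ((\<lambda>V. UNIV - vaught_set act V A) ` ?\<W>)" using \<G>(1) by simp
      moreover have "S \<in> ?\<Sigma>" if "S \<in> (\<lambda>V. UNIV - vaught_set act V A) ` ?\<W>" for S
        using that Compl op by (auto intro: sigma_sets.Compl)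
      ultimately show ?thesis by (simp only: sigma_sets_UNION)
    qed
    then show ?case using lc by blast
  next
    case (Union A)
    have "{h. act h x \<in> (\<Union>i. A i)} = (\<Union>i. {h. act h x \<in> A i})" for x by blast
    moreover have "vaught_set act U (\<Union>i. A i) = (\<Union>i. vaught_set act U (A i))" for U
      using vaught_set_Union[of "{U}" "range A" act] by simp
    moreover have "locally_comeagre \<G> (\<Union>i. {h. act h x \<in> A i})" for x
      using Union by (intro locally_comeagre_UN) blast
    moreover have "(\<Union>i. vaught_set act U (A i)) \<in> ?\<Sigma>" if "open U" for U
      using Union that by (intro sigma_sets.Union) blast
    ultimately show ?case by simp
  qed
  then show ?thesis using U by blast
qed

section \<open>Transforms of graded subsets: sublevel sets, measurability, duality\<close>

lemma open_sub_less: "open_graded_subset euclidean \<rho> \<Longrightarrow> open (sub_less \<rho> s)"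
  by (simp add: open_graded_subset_def)

text \<open>Below a bound c \<le> 1 neither the default element 1 of the infimum nor the truncation
  in \<open>dotted_add\<close> can be a witness, so the graded transform reduces to transforms of
  sublevel sets.\<close>

lemma vaught_delta_less_iff:
  assumes \<rho>: "open_graded_subset euclidean \<rho>" and c: "c \<le> 1"
  shows "vaught_delta act \<rho> \<phi> x < c \<longleftrightarrow>
    (\<exists>r s. r \<in> {0..1} \<and> s \<in> {0..1} \<and> r + s < c \<and> x \<in> vaught_set act (sub_less \<rho> s) (sub_less \<phi> r))"
proof -
  let ?S = "{dotted_add r s |r s. r \<in> {0..1} \<and> s \<in> {0..1} \<and>
            \<not> meagre_in_set (sub_less \<rho> s) {h. \<phi> (act h x) < r}}"
  have "bdd_below (insert 1 ?S)"
    by (rule bdd_belowI[of _ 0]) (auto simp: dotted_add_def)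
  then have "vaught_delta act \<rho> \<phi> x < c \<longleftrightarrow> (\<exists>z\<in>insert 1 ?S. z < c)"
    unfolding vaught_delta_def by (intro cInf_less_iff) auto
  also have "\<dots> \<longleftrightarrow> (\<exists>r s. r \<in> {0..1} \<and> s \<in> {0..1} \<and> dotted_add r s < c \<and>
      \<not> meagre_in_set (sub_less \<rho> s) {h. \<phi> (act h x) < r})"
    using c by auto
  also have "\<dots> \<longleftrightarrow> (\<exists>r s. r \<in> {0..1} \<and> s \<in> {0..1} \<and> r + s < c \<and>
      x \<in> vaught_set act (sub_less \<rho> s) (sub_less \<phi> r))"
  proof -
    have 1: "dotted_add r s < c \<longleftrightarrow> r + s < c" for r s using c by (auto simp: dotted_add_def)
    have 2: "(\<not> meagre_in_set (sub_less \<rho> s) {h. \<phi> (act h x) < r}) \<longleftrightarrow>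
        x \<in> vaught_set act (sub_less \<rho> s) (sub_less \<phi> r)" for r s
      unfolding meagre_in_set_open[OF open_sub_less[OF \<rho>]] by (simp add: vaught_set_def sub_less_def)
    show ?thesis unfolding 1 2 ..
  qed
  finally show ?thesis .
qed

lemma vaught_delta_bounds: "0 \<le> vaught_delta act \<rho> \<phi> x" "vaught_delta act \<rho> \<phi> x \<le> 1"
proof -
  let ?S = "{dotted_add r s |r s. r \<in> {0..1} \<and> s \<in> {0..1} \<and>
            \<not> meagre_in_set (sub_less \<rho> s) {h. \<phi> (act h x) < r}}"
  have *: "z \<in> insert 1 ?S \<Longrightarrow> 0 \<le> z" for z by (auto simp: dotted_add_def)
  show "0 \<le> vaught_delta act \<rho> \<phi> x"
    unfolding vaught_delta_def using * by (rule cInf_greatest[OF insert_not_empty])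
  show "vaught_delta act \<rho> \<phi> x \<le> 1"
    unfolding vaught_delta_def using * by (intro cInf_lower[OF insertI1] bdd_belowI[of _ 0])
qed

lemma vaught_delta_less_iff_rat:
  assumes \<rho>: "open_graded_subset euclidean \<rho>" and c: "c \<le> 1"
  shows "{x. vaught_delta act \<rho> \<phi> x < c} =
    (\<Union>r\<in>\<rat> \<inter> {0..1}. \<Union>s\<in>{s \<in> \<rat> \<inter> {0..1}. r + s < c}. vaught_set act (sub_less \<rho> s) (sub_less \<phi> r))"
    (is "_ = ?R")
proof
  show "?R \<subseteq> {x. vaught_delta act \<rho> \<phi> x < c}"
  proof
    fix x assume "x \<in> ?R"
    then obtain r s where "r \<in> {0..1}" "s \<in> {0..1}" "r + s < c"
        "x \<in> vaught_set act (sub_less \<rho> s) (sub_less \<phi> r)" by blast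
    then have "vaught_delta act \<rho> \<phi> x < c"
      by (intro vaught_delta_less_iff[OF assms, THEN iffD2] exI conjI)
    then show "x \<in> {x. vaught_delta act \<rho> \<phi> x < c}" by simp
  qed
  show "{x. vaught_delta act \<rho> \<phi> x < c} \<subseteq> ?R"
  proof
    fix x assume "x \<in> {x. vaught_delta act \<rho> \<phi> x < c}"
    then have "vaught_delta act \<rho> \<phi> x < c" by simp
    then obtain r s where rs: "r \<in> {0..1}" "s \<in> {0..1}" "r + s < c"
        "x \<in> vaught_set act (sub_less \<rho> s) (sub_less \<phi> r)"
      using vaught_delta_less_iff[OF assms, of act \<phi> x] by blast
    \<comment> \<open>Each grade is raised by less than half of the slack c - r - s. The sum stays
      below c \<le> 1, so both rationals remain in the unit interval.\<close>
    obtain r' where r': "r' \<in> \<rat>" "r < r'" "r' < r + (c - r - s) / 2"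
      using Rats_dense_in_real[of r "r + (c - r - s) / 2"] rs(3) by auto
    obtain s' where s': "s' \<in> \<rat>" "s < s'" "s' < s + (c - r - s) / 2"
      using Rats_dense_in_real[of s "s + (c - r - s) / 2"] rs(3) by auto
    have sum: "r' + s' < c" using r'(3) s'(3) by (simp add: field_simps)
    have "vaught_set act (sub_less \<rho> s) (sub_less \<phi> r) \<subseteq> vaught_set act (sub_less \<rho> s') (sub_less \<phi> r')"
      using r'(2) s'(2) by (intro vaught_set_mono) (auto simp: sub_less_def)
    then have "x \<in> vaught_set act (sub_less \<rho> s') (sub_less \<phi> r')" using rs(4) by blast
    moreover have "r' \<in> \<rat> \<inter> {0..1}" "s' \<in> \<rat> \<inter> {0..1}"
      using r' s' rs(1,2) sum c by auto
    ultimately show "x \<in> ?R" using sum by blast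
  qed
qed

lemma vaught_delta_Borel:
  fixes act :: "'g::{polish_space, topological_group_add} \<Rightarrow> 'x \<Rightarrow> 'x"
  assumes cont: "continuous_action act \<tau>" and top: "topspace \<tau> = UNIV"
    and \<rho>: "open_graded_subset euclidean \<rho>" and \<phi>: "borel_graded_subset \<tau> \<phi>"
  shows "borel_graded_subset \<tau> (vaught_delta act \<rho> \<phi>)"
  unfolding borel_graded_subset_def
proof (intro conjI borel_measurableI_less)
  let ?M = "sigma (topspace \<tau>) {U. openin \<tau> U}"
  show "graded_subset (vaught_delta act \<rho> \<phi>)" by (simp add: graded_subset_def vaught_delta_bounds)
  have "sub_less \<phi> r \<in> sigma_sets UNIV {U. openin \<tau> U}" for r
  proof -
    have "\<phi> \<in> borel_measurable ?M" using \<phi> by (simp add: borel_graded_subset_def)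
    then have "\<phi> -` {..<r} \<inter> space ?M \<in> sets ?M" by (rule measurable_sets) simp
    then show ?thesis by (simp add: vimage_def top sub_less_def)
  qed
  then have V: "vaught_set act (sub_less \<rho> s) (sub_less \<phi> r) \<in> sigma_sets UNIV {U. openin \<tau> U}" for r s
    using vaught_set_Borel[OF cont top] open_sub_less[OF \<rho>] by blast
  fix c :: real
  show "{x \<in> space ?M. vaught_delta act \<rho> \<phi> x < c} \<in> sets ?M"
  proof (cases "c \<le> 1")
    case True
    have V': "vaught_set act (sub_less \<rho> s) (sub_less \<phi> r) \<in> sets ?M" for r s
      using V by (simp add: top)
    have "countable {s \<in> \<rat> \<inter> {0..1}. r + s < c}" for r :: real
      by (rule countable_subset[OF _ countable_rat]) auto
    then have "(\<Union>s\<in>{s \<in> \<rat> \<inter> {0..1}. r + s < c}. vaught_set act (sub_less \<rho> s) (sub_less \<phi> r)) \<in> sets ?M" for r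
      using V' by (intro sets.countable_UN') auto
    moreover have "countable (\<rat> \<inter> {0..1} :: real set)"
      by (rule countable_subset[OF _ countable_rat]) auto
    ultimately have "(\<Union>r\<in>\<rat> \<inter> {0..1}. \<Union>s\<in>{s \<in> \<rat> \<inter> {0..1}. r + s < c}.
        vaught_set act (sub_less \<rho> s) (sub_less \<phi> r)) \<in> sets ?M"
      by (intro sets.countable_UN') auto
    then show ?thesis using vaught_delta_less_iff_rat[OF \<rho> True, of act \<phi>] by (simp add: top)
  next
    case False
    then have "vaught_delta act \<rho> \<phi> x < c" for x
      using vaught_delta_bounds(2)[of act \<rho> \<phi> x] by linarith
    then have "{x \<in> space ?M. vaught_delta act \<rho> \<phi> x < c} = space ?M" by blast
    then show ?thesis by (simp only: sets.top)
  qed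
qed

text \<open>Comeagreness of \<open>\<phi> \<le> r\<close> is meagreness of
  \<open>1 - \<phi> < 1 - r\<close>, and z \<mapsto> 1 - z exchanges supremum with infimum and also
  the default values 0 and 1. Every closure property of the star transform thus follows from that of
  the delta transform.\<close>

lemma vaught_star_eq:
  "vaught_star act \<rho> \<phi> = (\<lambda>x. 1 - vaught_delta act \<rho> (\<lambda>x. 1 - \<phi> x) x)"
proof
  fix x
  let ?Z = "insert 0 {dotted_diff r s |r s. r \<in> {0..1} \<and> s \<in> {0..1} \<and>
            \<not> comeagre_in_set (sub_less \<rho> s) {h. \<phi> (act h x) \<le> r}}"
  let ?S = "insert 1 {dotted_add r s |r s. r \<in> {0..1} \<and> s \<in> {0..1} \<and>
            \<not> meagre_in_set (sub_less \<rho> s) {h. 1 - \<phi> (act h x) < r}}"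
  have eq: "comeagre_in_set (sub_less \<rho> s) {h. \<phi> (act h x) \<le> r} \<longleftrightarrow>
      meagre_in_set (sub_less \<rho> s) {h. 1 - \<phi> (act h x) < 1 - r}" for r s
  proof -
    have "sub_less \<rho> s - sub_less \<rho> s \<inter> {h. \<phi> (act h x) \<le> r} =
        sub_less \<rho> s \<inter> {h. 1 - \<phi> (act h x) < 1 - r}" by auto
    then show ?thesis by (simp add: comeagre_in_set_def comeagre_in_def meagre_in_set_def)
  qed
  have dd: "1 - dotted_diff r s = dotted_add (1 - r) s" for r s
    by (auto simp: dotted_diff_def dotted_add_def)
  have "?S = (\<lambda>z. 1 - z) ` ?Z"
  proof (intro equalityI subsetI)
    fix z assume "z \<in> ?S"
    then consider "z = 1" | r s where "z = dotted_add r s" "r \<in> {0..1}" "s \<in> {0..1}"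
        "\<not> meagre_in_set (sub_less \<rho> s) {h. 1 - \<phi> (act h x) < r}" by blast
    then show "z \<in> (\<lambda>z. 1 - z) ` ?Z"
    proof cases
      case 2
      then have "dotted_diff (1 - r) s \<in> ?Z"
        using eq[of s "1 - r"] by (intro insertI2 CollectI exI[of _ "1 - r"] exI[of _ s]) simp
      moreover have "z = 1 - dotted_diff (1 - r) s" using dd[of "1 - r" s] 2(1) by simp
      ultimately show ?thesis by (rule rev_image_eqI)
    qed simp
  next
    fix z assume "z \<in> (\<lambda>z. 1 - z) ` ?Z"
    then consider "z = 1" | r s where "z = 1 - dotted_diff r s" "r \<in> {0..1}" "s \<in> {0..1}"
        "\<not> comeagre_in_set (sub_less \<rho> s) {h. \<phi> (act h x) \<le> r}" by auto
    then show "z \<in> ?S"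
    proof cases
      case 2
      then show ?thesis
        using eq[of s r] dd[of r s] by (intro insertI2 CollectI exI[of _ "1 - r"] exI[of _ s]) simp
    qed simp
  qed
  moreover have "Inf ((\<lambda>z. 1 - z) ` ?Z) = 1 - Sup ?Z"
  proof (rule cInf_eq)
    have bdd: "bdd_above ?Z" by (rule bdd_aboveI[of _ 1]) (auto simp: dotted_diff_def)
    show "1 - Sup ?Z \<le> y" if y: "y \<in> (\<lambda>z. 1 - z) ` ?Z" for y
    proof -
      obtain z where z: "z \<in> ?Z" "y = 1 - z" using y by (rule imageE)
      then show ?thesis using cSup_upper[OF z(1) bdd] by simp
    qed
    fix y assume y: "\<And>z. z \<in> (\<lambda>z. 1 - z) ` ?Z \<Longrightarrow> y \<le> z"
    have "Sup ?Z \<le> 1 - y"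
    proof (rule cSup_least)
      fix z assume "z \<in> ?Z"
      then have "y \<le> 1 - z" by (intro y imageI)
      then show "z \<le> 1 - y" by simp
    qed simp
    then show "y \<le> 1 - Sup ?Z" by simp
  qed
  ultimately show "vaught_star act \<rho> \<phi> x = 1 - vaught_delta act \<rho> (\<lambda>x. 1 - \<phi> x) x"
    unfolding vaught_star_def vaught_delta_def by simp
qed

section \<open>Invariance of transforms along graded cosets\<close>

lemma graded_subgroup_minus: "graded_subgroup H \<Longrightarrow> H (- g) = H g"
  unfolding graded_subgroup_def by (elim conjE) (erule allE, erule sym)

lemma graded_subgroup_add: "graded_subgroup H \<Longrightarrow> H (g + g') \<le> H g + H g'"
  unfolding graded_subgroup_def by blast

lemma graded_subgroup_ge_0: "graded_subgroup H \<Longrightarrow> 0 \<le> H g"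
  unfolding graded_subgroup_def graded_subset_def by blast

lemma graded_subgroup_le_1: "graded_subgroup H \<Longrightarrow> H g \<le> 1"
  unfolding graded_subgroup_def graded_subset_def by blast

lemma graded_subgroup_0: "graded_subgroup H \<Longrightarrow> H 0 = 0"
  unfolding graded_subgroup_def by blast

lemma graded_conjugate_subgroup:
  assumes "graded_subgroup H"
  shows "graded_subgroup (graded_conjugate H g)"
  unfolding graded_subgroup_def
proof (intro conjI allI)
  show "graded_subset (graded_conjugate H g)" "graded_conjugate H g 0 = 0"
    using assms by (auto simp: graded_subgroup_def graded_subset_def graded_conjugate_def)
  fix h h'
  have "g + - h + - g = - (g + h + - g)"
    by (simp add: minus_add add.assoc del: add_uminus_conv_diff)
  then show "graded_conjugate H g h = graded_conjugate H g (- h)"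
    unfolding graded_conjugate_def by (simp only: graded_subgroup_minus[OF assms])
  have "g + (h + h') + - g = (g + h + - g) + (g + h' + - g)"
    by (simp add: add.assoc del: add_uminus_conv_diff)
  then show "graded_conjugate H g (h + h') \<le> graded_conjugate H g h + graded_conjugate H g h'"
    using graded_subgroup_add[OF assms] by (simp add: graded_conjugate_def)
qed

text \<open>Passing from x to kx translates the set of witnesses on the right by the inverse of k,
  which preserves non-meagreness. Multiplicatively, h g^-1 = (h k g^-1)(g k g^-1)^-1, so the coset
  grade of a witness grows by at most the conjugate's grade at k.\<close>

lemma vaught_delta_invariant:
  fixes act :: "'g::topological_group_add \<Rightarrow> 'x \<Rightarrow> 'x"
  assumes act: "is_action act" and H: "graded_subgroup H"
    and \<rho>: "open_graded_subset euclidean (graded_coset H g)"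
  shows "graded_invariant act (graded_conjugate H g) (vaught_delta act (graded_coset H g) \<phi>)"
  unfolding graded_invariant_def
proof (intro allI)
  fix k x
  let ?e = "graded_conjugate H g k" and ?\<rho> = "graded_coset H g"
  let ?v = "vaught_delta act ?\<rho> \<phi>"
  have e0: "0 \<le> ?e" by (rule graded_subgroup_ge_0[OF graded_conjugate_subgroup[OF H]])
  have "?v (act k x) \<le> ?v x + ?e"
  proof (rule ccontr)
    assume neg: "\<not> ?thesis"
    let ?c = "?v (act k x)"
    have c1: "?c \<le> 1" by (rule vaught_delta_bounds)
    have "?v x < ?c - ?e" using neg by simp
    then obtain r s where rs: "r \<in> {0..1}" "s \<in> {0..1}" "r + s < ?c - ?e"
        "x \<in> vaught_set act (sub_less ?\<rho> s) (sub_less \<phi> r)"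
      using vaught_delta_less_iff[OF \<rho>, of "?c - ?e" act \<phi> x] c1 e0 by auto
    have sub: "(\<lambda>h. h + k) -` (sub_less ?\<rho> s \<inter> {h. act h x \<in> sub_less \<phi> r}) \<subseteq>
        sub_less ?\<rho> (s + ?e) \<inter> {h. act h (act k x) \<in> sub_less \<phi> r}"
    proof
      fix h assume h: "h \<in> (\<lambda>h. h + k) -` (sub_less ?\<rho> s \<inter> {h. act h x \<in> sub_less \<phi> r})"
      have "h + - g = (h + k + - g) + - (g + k + - g)"
        by (simp add: minus_add add.assoc del: add_uminus_conv_diff)
      then have "H (h + - g) \<le> H (h + k + - g) + H (- (g + k + - g))"
        using graded_subgroup_add[OF H, of "h + k + - g" "- (g + k + - g)"] by simp
      also have "H (- (g + k + - g)) = ?e"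
        unfolding graded_conjugate_def by (rule graded_subgroup_minus[OF H])
      finally have "?\<rho> h < s + ?e" using h by (simp add: graded_coset_def sub_less_def)
      moreover have "act (h + k) x = act h (act k x)" using act by (simp add: is_action_def)
      ultimately show "h \<in> sub_less ?\<rho> (s + ?e) \<inter> {h. act h (act k x) \<in> sub_less \<phi> r}"
        using h by (simp add: sub_less_def)
    qed
    have "\<not> meagre_in euclidean ((\<lambda>h. h + k) -` (sub_less ?\<rho> s \<inter> {h. act h x \<in> sub_less \<phi> r}))"
      unfolding meagre_in_translate using rs(4) by (simp add: vaught_set_def)
    then have "\<not> meagre_in euclidean (sub_less ?\<rho> (s + ?e) \<inter> {h. act h (act k x) \<in> sub_less \<phi> r})"
      using meagre_in_subset[OF _ sub] by blast
    then have "act k x \<in> vaught_set act (sub_less ?\<rho> (s + ?e)) (sub_less \<phi> r)"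
      by (simp add: vaught_set_def)
    moreover have "s + ?e \<in> {0..1}" "r + (s + ?e) < ?c" using rs e0 c1 by auto
    ultimately have "?v (act k x) < ?c"
      using rs(1) by (intro vaught_delta_less_iff[OF \<rho> c1, THEN iffD2] exI conjI)
    then show False by simp
  qed
  then show "?v (act k x) \<le> dotted_add (?v x) ?e"
    by (simp add: dotted_add_def vaught_delta_bounds)
qed

section \<open>Families closed under the operations\<close>

text \<open>A small generating set of operations: minimum, maximum, truncated sum and absolute
  difference are compositions of complement and truncated difference (the Lukasiewicz connectives),
  and star is dual to delta. Nonemptiness provides the rational constants.\<close>

definition closed_family :: "('g::topological_group_add \<Rightarrow> 'x \<Rightarrow> 'x) \<Rightarrow> ('g \<Rightarrow> real) set \<Rightarrow> ('x \<Rightarrow> real) set \<Rightarrow> bool" where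
  "closed_family act \<R> A \<longleftrightarrow> A \<noteq> {} \<and> (\<forall>\<phi>\<in>A. graded_subset \<phi>) \<and>
     (\<forall>\<phi>\<in>A. (\<lambda>x. 1 - \<phi> x) \<in> A) \<and>
     (\<forall>\<phi>\<in>A. \<forall>\<psi>\<in>A. (\<lambda>x. dotted_diff (\<phi> x) (\<psi> x)) \<in> A) \<and>
     (\<forall>\<phi>\<in>A. \<forall>q\<in>\<rat>. 0 < q \<longrightarrow> dotted_scale q \<phi> \<in> A) \<and>
     (\<forall>\<phi>\<in>A. \<forall>\<rho>\<in>\<R>. vaught_delta act \<rho> \<phi> \<in> A)"

context
  fixes act :: "'g::topological_group_add \<Rightarrow> 'x \<Rightarrow> 'x" and \<R> A
  assumes A: "closed_family act \<R> A"
begin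

lemma closed_family_bounds: "\<phi> \<in> A \<Longrightarrow> 0 \<le> \<phi> x" "\<phi> \<in> A \<Longrightarrow> \<phi> x \<le> 1"
  using A unfolding closed_family_def graded_subset_def by blast+

lemma closed_family_neg: "\<phi> \<in> A \<Longrightarrow> (\<lambda>x. 1 - \<phi> x) \<in> A"
  using A unfolding closed_family_def by blast

lemma closed_family_diff: "\<phi> \<in> A \<Longrightarrow> \<psi> \<in> A \<Longrightarrow> (\<lambda>x. dotted_diff (\<phi> x) (\<psi> x)) \<in> A"
  using A unfolding closed_family_def by blast

lemma closed_family_scale: "\<phi> \<in> A \<Longrightarrow> q \<in> \<rat> \<Longrightarrow> 0 < q \<Longrightarrow> dotted_scale q \<phi> \<in> A"
  using A unfolding closed_family_def by blast

lemma closed_family_delta: "\<phi> \<in> A \<Longrightarrow> \<rho> \<in> \<R> \<Longrightarrow> vaught_delta act \<rho> \<phi> \<in> A"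
  using A unfolding closed_family_def by blast

lemma closed_family_star: "\<phi> \<in> A \<Longrightarrow> \<rho> \<in> \<R> \<Longrightarrow> vaught_star act \<rho> \<phi> \<in> A"
  unfolding vaught_star_eq by (intro closed_family_neg closed_family_delta)

lemma closed_family_min:
  assumes "\<phi> \<in> A" "\<psi> \<in> A"
  shows "(\<lambda>x. min (\<phi> x) (\<psi> x)) \<in> A"
proof -
  have "min (\<phi> x) (\<psi> x) = dotted_diff (\<phi> x) (dotted_diff (\<phi> x) (\<psi> x))" for x
    using closed_family_bounds[OF assms(1), of x] closed_family_bounds[OF assms(2), of x]
    by (auto simp: dotted_diff_def)
  then show ?thesis using assms by (simp add: closed_family_diff)
qed

lemma closed_family_max:
  assumes "\<phi> \<in> A" "\<psi> \<in> A"
  shows "(\<lambda>x. max (\<phi> x) (\<psi> x)) \<in> A"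
proof -
  have "max (\<phi> x) (\<psi> x) = 1 - min (1 - \<phi> x) (1 - \<psi> x)" for x by (simp add: min_def max_def)
  then show ?thesis
    using closed_family_neg[OF closed_family_min[OF closed_family_neg closed_family_neg]] assms by simp
qed

lemma closed_family_add:
  assumes "\<phi> \<in> A" "\<psi> \<in> A"
  shows "(\<lambda>x. dotted_add (\<phi> x) (\<psi> x)) \<in> A"
proof -
  have "dotted_add (\<phi> x) (\<psi> x) = 1 - dotted_diff (1 - \<phi> x) (\<psi> x)" for x
    by (auto simp: dotted_add_def dotted_diff_def)
  then show ?thesis
    using closed_family_neg[OF closed_family_diff[OF closed_family_neg]] assms by simp
qed

lemma closed_family_abs:
  assumes "\<phi> \<in> A" "\<psi> \<in> A"
  shows "(\<lambda>x. \<bar>\<phi> x - \<psi> x\<bar>) \<in> A"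
proof -
  have "\<bar>\<phi> x - \<psi> x\<bar> = max (dotted_diff (\<phi> x) (\<psi> x)) (dotted_diff (\<psi> x) (\<phi> x))" for x
    by (auto simp: dotted_diff_def)
  then show ?thesis
    using closed_family_max[OF closed_family_diff closed_family_diff] assms by simp
qed

lemma closed_family_const:
  assumes "q \<in> \<rat>" "0 \<le> q" "q \<le> 1"
  shows "(\<lambda>x. q) \<in> A"
proof -
  obtain \<phi> where "\<phi> \<in> A" using A unfolding closed_family_def by blast
  then have 0: "(\<lambda>x. 0) \<in> A" using closed_family_diff[of \<phi> \<phi>] by (simp add: dotted_diff_def)
  show ?thesis
  proof (cases "q = 0")
    case False
    have "dotted_scale q (\<lambda>x. 1 - 0) \<in> A"
      using False assms by (intro closed_family_scale closed_family_neg 0) auto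
    then show ?thesis using assms by (simp add: dotted_scale_def min_def)
  qed (simp add: 0)
qed

text \<open>Rescaling brings two sublevel sets to a common threshold, where their intersection is a
  sublevel set of the maximum; so the subbasis is essentially already a basis.\<close>

lemma closed_family_graded_basis: "graded_basis (graded_generated_topology A) A"
proof -
  let ?t = "graded_generated_topology A"
  let ?P = "\<lambda>V. \<exists>\<phi> r. V = sub_less \<phi> r \<and> \<phi> \<in> A \<and> r \<in> \<rat> \<and> 0 < r \<and> r < 1"
  have all: "?P UNIV"
  proof (intro exI conjI)
    show "UNIV = sub_less (\<lambda>x. 0 :: real) (1/2)" by (simp add: sub_less_def)
    show "(\<lambda>x. 0) \<in> A" by (rule closed_family_const) auto
  qed auto
  have "\<forall>x\<in>U. \<exists>V. ?P V \<and> x \<in> V \<and> V \<subseteq> U"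
    if "generate_topology_on (insert UNIV {sub_less \<phi> r |\<phi> r. \<phi> \<in> A}) U" for U
    using that
  proof induction
    case (Int a b)
    show ?case
    proof
      fix x assume x: "x \<in> a \<inter> b"
      obtain \<phi> r where 1: "sub_less \<phi> r \<subseteq> a" "x \<in> sub_less \<phi> r" "\<phi> \<in> A" "r \<in> \<rat>" "0 < r" "r < 1"
        using Int.IH(1) x by blast
      obtain \<psi> s where 2: "sub_less \<psi> s \<subseteq> b" "x \<in> sub_less \<psi> s" "\<psi> \<in> A" "s \<in> \<rat>" "0 < s" "s < 1"
        using Int.IH(2) x by blast
      \<comment> \<open>The factors 1/(2r) and 1/(2s) move both thresholds to 1/2, safely below the
        value 1 at which scaling truncates.\<close>
      let ?\<theta> = "\<lambda>x. max (dotted_scale (1 / (2 * r)) \<phi> x) (dotted_scale (1 / (2 * s)) \<psi> x)"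
      have \<theta>: "?\<theta> \<in> A"
        using 1 2 by (intro closed_family_max closed_family_scale) auto
      have "sub_less ?\<theta> (1/2) = sub_less \<phi> r \<inter> sub_less \<psi> s"
      proof -
        have half: "dotted_scale q \<theta> y < 1/2 \<longleftrightarrow> q * \<theta> y < 1/2" for q \<theta> and y :: 'x
          unfolding dotted_scale_def min_less_iff_disj by auto
        have "dotted_scale (1 / (2 * r)) \<phi> y < 1/2 \<longleftrightarrow> \<phi> y < r" for y
          using 1(5) unfolding half by (simp add: field_simps)
        moreover have "dotted_scale (1 / (2 * s)) \<psi> y < 1/2 \<longleftrightarrow> \<psi> y < s" for y
          using 2(5) unfolding half by (simp add: field_simps)
        ultimately have "max (dotted_scale (1 / (2 * r)) \<phi> y) (dotted_scale (1 / (2 * s)) \<psi> y) < 1/2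
            \<longleftrightarrow> \<phi> y < r \<and> \<psi> y < s" for y
          by (simp only: max_less_iff_conj)
        then show ?thesis by (auto simp only: sub_less_def)
      qed
      moreover have "?P (sub_less ?\<theta> (1/2))"
        using \<theta> by (intro exI[of _ ?\<theta>] exI[of _ "1/2"]) auto
      ultimately have "?P (sub_less \<phi> r \<inter> sub_less \<psi> s)" by simp
      then show "\<exists>V. ?P V \<and> x \<in> V \<and> V \<subseteq> a \<inter> b" using 1(1,2) 2(1,2) by blast
    qed
  next
    case (UN K)
    show ?case
    proof
      fix x assume "x \<in> \<Union>K"
      then obtain k where k: "k \<in> K" "x \<in> k" by blast
      then obtain V where "?P V" "x \<in> V" "V \<subseteq> k" using UN.IH[OF k(1)] by blast
      moreover from this k(1) have "V \<subseteq> \<Union>K" by blast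
      ultimately show "\<exists>V. ?P V \<and> x \<in> V \<and> V \<subseteq> \<Union>K" by blast
    qed
  next
    case (Basis U)
    show ?case
    proof
      fix x assume x: "x \<in> U"
      show "\<exists>V. ?P V \<and> x \<in> V \<and> V \<subseteq> U"
      proof (cases "U = UNIV")
        case True
        then show ?thesis using all by blast
      next
        case False
        then obtain \<phi> r where U: "U = sub_less \<phi> r" "\<phi> \<in> A" using Basis by blast
        then have "\<phi> x < r" using x by (simp add: sub_less_def)
        \<comment> \<open>A threshold above 1 would give the whole space, the case treated before.
          The bound ensures that a rational q below r is also below 1.\<close>
        moreover have "r \<le> 1"
        proof (rule ccontr)
          assume "\<not> r \<le> 1"
          then have "\<phi> y < r" for y using closed_family_bounds(2)[OF U(2), of y] by linarith
          then have "U = UNIV" using U(1) by (simp add: sub_less_def)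
          then show False using False by contradiction
        qed
        ultimately have "\<exists>q\<in>\<rat>. \<phi> x < q \<and> q < r" by (intro Rats_dense_in_real)
        then obtain q where q: "q \<in> \<rat>" "\<phi> x < q" "q < r" by blast
        have "0 < q" "q < 1" using q \<open>r \<le> 1\<close> closed_family_bounds(1)[OF U(2), of x] by linarith+
        moreover have "x \<in> sub_less \<phi> q" "sub_less \<phi> q \<subseteq> U" using q U(1) by (auto simp: sub_less_def)
        ultimately show ?thesis
          using q(1) U(2) by (intro exI[of _ "sub_less \<phi> q"] conjI exI[of _ \<phi>] exI[of _ q] refl)
      qed
    qed
  qed simp
  then have "\<exists>V. ?P V \<and> x \<in> V \<and> V \<subseteq> U" if "openin ?t U" "x \<in> U" for U x
    using that unfolding graded_generated_topology_def openin_topology_generated_by_iff by blast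
  moreover have "openin ?t V" if "?P V" for V
    using that graded_generated_openin by blast
  ultimately have "is_basis ?t {sub_less \<phi> r |\<phi> r. \<phi> \<in> A \<and> r \<in> \<rat> \<and> 0 < r \<and> r < 1}"
    unfolding is_basis_def openin_topology_base_unique mem_Collect_eq by (intro conjI allI impI) simp_all
  moreover have "open_graded_subset ?t \<phi>" if "\<phi> \<in> A" for \<phi>
    using closed_family_bounds[OF that] graded_generated_openin[OF that]
    by (simp add: open_graded_subset_def graded_subset_def)
  ultimately show ?thesis by (simp add: graded_basis_def)
qed

end

section \<open>Closing a countable Borel family under the operations\<close>

definition closure_step ::
    "('g::topological_group_add \<Rightarrow> 'x \<Rightarrow> 'x) \<Rightarrow> ('g \<Rightarrow> real) set \<Rightarrow> ('x \<Rightarrow> real) set \<Rightarrow> ('x \<Rightarrow> real) set" where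
  "closure_step act \<R> C = C \<union> (\<lambda>\<phi> x. 1 - \<phi> x) ` C \<union> (\<lambda>(\<phi>, \<psi>) x. dotted_diff (\<phi> x) (\<psi> x)) ` (C \<times> C) \<union>
     (\<lambda>(q, \<phi>). dotted_scale q \<phi>) ` ((\<rat> \<inter> {0<..}) \<times> C) \<union> (\<lambda>(\<rho>, \<phi>). vaught_delta act \<rho> \<phi>) ` (\<R> \<times> C)"

lemma closure_step_extensive: "C \<subseteq> closure_step act \<R> C"
  unfolding closure_step_def by blast

lemma closure_step_neg: "\<phi> \<in> C \<Longrightarrow> (\<lambda>x. 1 - \<phi> x) \<in> closure_step act \<R> C"
  unfolding closure_step_def by (intro UnI1[OF UnI1[OF UnI1[OF UnI2]]] imageI)

lemma closure_step_diff:
  "\<phi> \<in> C \<Longrightarrow> \<psi> \<in> C \<Longrightarrow> (\<lambda>x. dotted_diff (\<phi> x) (\<psi> x)) \<in> closure_step act \<R> C"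
  unfolding closure_step_def by (intro UnI1[OF UnI1[OF UnI2]] image_eqI[of _ _ "(\<phi>, \<psi>)"]) auto

lemma closure_step_scale: "\<phi> \<in> C \<Longrightarrow> q \<in> \<rat> \<Longrightarrow> 0 < q \<Longrightarrow> dotted_scale q \<phi> \<in> closure_step act \<R> C"
  unfolding closure_step_def by (intro UnI1[OF UnI2] image_eqI[of _ _ "(q, \<phi>)"]) auto

lemma closure_step_delta: "\<phi> \<in> C \<Longrightarrow> \<rho> \<in> \<R> \<Longrightarrow> vaught_delta act \<rho> \<phi> \<in> closure_step act \<R> C"
  unfolding closure_step_def by (intro UnI2 image_eqI[of _ _ "(\<rho>, \<phi>)"]) auto

lemma countable_closure_step:
  assumes "countable \<R>" "countable C"
  shows "countable (closure_step act \<R> C)"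
proof -
  have "countable (\<rat> \<inter> {0<..} :: real set)" by (rule countable_subset[OF _ countable_rat]) auto
  then show ?thesis unfolding closure_step_def using assms by (intro countable_Un countable_image countable_SIGMA)
qed

lemma Borel_closure_step:
  fixes act :: "'g::{polish_space, topological_group_add} \<Rightarrow> 'x \<Rightarrow> 'x"
  assumes cont: "continuous_action act \<tau>" and top: "topspace \<tau> = UNIV"
    and \<R>: "\<And>\<rho>. \<rho> \<in> \<R> \<Longrightarrow> open_graded_subset euclidean \<rho>"
    and C: "\<And>\<phi>. \<phi> \<in> C \<Longrightarrow> borel_graded_subset \<tau> \<phi>"
    and \<phi>: "\<phi> \<in> closure_step act \<R> C"
  shows "borel_graded_subset \<tau> \<phi>"
proof -
  let ?M = "sigma (topspace \<tau>) {U. openin \<tau> U}"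
  have m: "\<psi> \<in> borel_measurable ?M" and b: "0 \<le> \<psi> x" "\<psi> x \<le> 1" if "\<psi> \<in> C" for \<psi> x
    using C[OF that] by (auto simp: borel_graded_subset_def graded_subset_def)
  consider "\<phi> \<in> C" | \<psi> where "\<psi> \<in> C" "\<phi> = (\<lambda>x. 1 - \<psi> x)"
    | \<psi> \<theta> where "\<psi> \<in> C" "\<theta> \<in> C" "\<phi> = (\<lambda>x. dotted_diff (\<psi> x) (\<theta> x))"
    | q \<psi> where "0 < q" "\<psi> \<in> C" "\<phi> = dotted_scale q \<psi>"
    | \<rho> \<psi> where "\<rho> \<in> \<R>" "\<psi> \<in> C" "\<phi> = vaught_delta act \<rho> \<psi>"
    using \<phi> unfolding closure_step_def by auto
  then show ?thesis
  proof cases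
    case 1
    then show ?thesis by (rule C)
  next
    case 2
    then show ?thesis using m[OF 2(1)] b[OF 2(1)]
      by (auto simp: borel_graded_subset_def graded_subset_def)
  next
    case 3
    have "dotted_diff (\<psi> x) (\<theta> x) \<le> 1" "0 \<le> dotted_diff (\<psi> x) (\<theta> x)" for x
      using b[OF 3(1), of x] b[OF 3(2), of x] by (auto simp: dotted_diff_def)
    moreover have "(\<lambda>x. dotted_diff (\<psi> x) (\<theta> x)) \<in> borel_measurable ?M"
      unfolding dotted_diff_def using m[OF 3(1)] m[OF 3(2)]
      by (intro borel_measurable_max borel_measurable_diff) auto
    ultimately show ?thesis by (simp add: borel_graded_subset_def graded_subset_def 3(3))
  next
    case 4
    have "dotted_scale q \<psi> \<in> borel_measurable ?M"
      unfolding dotted_scale_def using m[OF 4(2)]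
      by (intro borel_measurable_min borel_measurable_times) auto
    moreover have "0 \<le> dotted_scale q \<psi> x" "dotted_scale q \<psi> x \<le> 1" for x
      using b[OF 4(2), of x] 4(1) by (auto simp: dotted_scale_def)
    ultimately show ?thesis by (simp add: borel_graded_subset_def graded_subset_def 4(3))
  next
    case 5
    then show ?thesis using vaught_delta_Borel[OF cont top \<R> C] by simp
  qed
qed

text \<open>Resolving a family adds auxiliary functions that destroy closure, and closing it
  destroys the G-delta graph. The two are alternated infinitely often: the union is closed because
  each operation applied at one stage lands in the next, and resolved because joins of resolved
  sequences are.\<close>

lemma closed_resolved_family_exists:
  fixes act :: "'g::{polish_space, topological_group_add} \<Rightarrow> 'x \<Rightarrow> 'x"
  assumes G: "polish_G_space act \<tau>" and \<R>: "countable \<R>" "\<And>\<rho>. \<rho> \<in> \<R> \<Longrightarrow> open_graded_subset euclidean \<rho>"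
    and F: "countable \<F>" "\<And>\<phi>. \<phi> \<in> \<F> \<Longrightarrow> borel_graded_subset \<tau> \<phi>"
  shows "\<exists>f. resolved \<tau> f \<and> \<F> \<subseteq> range f \<and> closed_family act \<R> (range f)"
proof -
  have pol: "polish_topology \<tau>" and cont: "continuous_action act \<tau>"
    using G by (auto simp: polish_G_space_def)
  note top = polish_topspace[OF pol]
  \<comment> \<open>One alternation, fixed by choice as a function so that it can be
    iterated.\<close>
  define nxt where "nxt f = (SOME g. resolved \<tau> g \<and> closure_step act \<R> (range f) \<subseteq> range g)" for f :: "nat \<Rightarrow> 'x \<Rightarrow> real"
  have "resolved \<tau> (nxt f) \<and> closure_step act \<R> (range f) \<subseteq> range (nxt f)" if f: "resolved \<tau> f" for f
    unfolding nxt_def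
  proof (rule someI_ex[where P = "\<lambda>g. resolved \<tau> g \<and> closure_step act \<R> (range f) \<subseteq> range g"],
      rule resolved_countable_family[OF pol])
    show "countable (closure_step act \<R> (range f))" by (intro countable_closure_step \<R>(1)) simp
    have "borel_graded_subset \<tau> \<psi>" if "\<psi> \<in> range f" for \<psi>
      using that f by (auto simp: resolved_def)
    then show "borel_graded_subset \<tau> \<phi>" if "\<phi> \<in> closure_step act \<R> (range f)" for \<phi>
      using Borel_closure_step[OF cont top \<R>(2) _ that] by blast
  qed
  then have nxt: "\<And>f. resolved \<tau> f \<Longrightarrow> resolved \<tau> (nxt f)"
      "\<And>f. resolved \<tau> f \<Longrightarrow> closure_step act \<R> (range f) \<subseteq> range (nxt f)"
    by simp_all
  obtain f0 where f0: "resolved \<tau> f0" "\<F> \<subseteq> range f0"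
    using resolved_countable_family[OF pol F] by blast
  define f where "f n = (nxt ^^ n) f0" for n
  have res: "resolved \<tau> (f n)" for n
    by (induction n) (simp_all add: f_def f0 nxt)
  have step: "closure_step act \<R> (range (f n)) \<subseteq> range (f (Suc n))" for n
    using nxt(2)[OF res[of n]] by (simp add: f_def)
  then have "range (f n) \<subseteq> range (f (Suc n))" for n
    using closure_step_extensive by (rule subset_trans[rotated])
  then have mono: "range (f m) \<subseteq> range (f n)" if "m \<le> n" for m n
    using that by (rule lift_Suc_mono_le[of "\<lambda>n. range (f n)"])
  have sub: "range (f n) \<subseteq> range (join f)" for n
    unfolding range_join by (rule UN_upper) simp
  have step': "\<theta> \<in> closure_step act \<R> (range (f n)) \<Longrightarrow> \<theta> \<in> range (join f)" for \<theta> n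
    using step[of n] sub[of "Suc n"] by (meson subsetD)
  have rj: "resolved \<tau> (join f)" by (rule resolved_join[OF pol res])
  have "closed_family act \<R> (range (join f))"
    unfolding closed_family_def
  proof (intro conjI ballI impI)
    show "range (join f) \<noteq> {}" by simp
    fix \<phi> assume \<phi>: "\<phi> \<in> range (join f)"
    then show "graded_subset \<phi>"
      using rj by (auto simp: resolved_def borel_graded_subset_def)
    obtain m where m: "\<phi> \<in> range (f m)" using \<phi> unfolding range_join by (rule UN_E)
    then show "(\<lambda>x. 1 - \<phi> x) \<in> range (join f)" by (intro step' closure_step_neg)
    show "dotted_scale q \<phi> \<in> range (join f)" if "q \<in> \<rat>" "0 < q" for q
      using m that by (intro step' closure_step_scale)
    show "vaught_delta act \<rho> \<phi> \<in> range (join f)" if "\<rho> \<in> \<R>" for \<rho>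
      using m that by (intro step' closure_step_delta)
    fix \<psi> assume "\<psi> \<in> range (join f)"
    then obtain n where n: "\<psi> \<in> range (f n)" unfolding range_join by (rule UN_E)
    have "\<phi> \<in> range (f (max m n))" "\<psi> \<in> range (f (max m n))"
      using subsetD[OF mono m, of "max m n"] subsetD[OF mono n, of "max m n"] by simp_all
    then show "(\<lambda>x. dotted_diff (\<phi> x) (\<psi> x)) \<in> range (join f)" by (intro step' closure_step_diff)
  qed
  moreover have "\<F> \<subseteq> range (join f)"
    using f0(2) sub[of 0] by (simp add: f_def)
  ultimately show ?thesis using rj by blast
qed

section \<open>Invariant members of a closed family\<close>

lemma graded_subgroup_max:
  assumes "graded_subgroup H" "graded_subgroup K"
  shows "graded_subgroup (\<lambda>g. max (H g) (K g))"
  unfolding graded_subgroup_def graded_subset_def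
proof (intro conjI allI)
  fix g g'
  note b = graded_subgroup_ge_0[OF assms(1)] graded_subgroup_le_1[OF assms(1)]
    graded_subgroup_ge_0[OF assms(2)] graded_subgroup_le_1[OF assms(2)]
  show "0 \<le> max (H g) (K g)" using b(1)[of g] by linarith
  show "max (H g) (K g) \<le> 1" using b(2)[of g] b(4)[of g] by linarith
  show "max (H 0) (K 0) = 0" using graded_subgroup_0[OF assms(1)] graded_subgroup_0[OF assms(2)] by simp
  show "max (H g) (K g) = max (H (- g)) (K (- g))"
    by (simp only: graded_subgroup_minus[OF assms(1)] graded_subgroup_minus[OF assms(2)])
  show "max (H (g + g')) (K (g + g')) \<le> max (H g) (K g) + max (H g') (K g')"
    using graded_subgroup_add[OF assms(1), of g g'] graded_subgroup_add[OF assms(2), of g g'] by linarith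
qed

lemma graded_subgroup_scale:
  assumes "graded_subgroup H" "0 < q"
  shows "graded_subgroup (dotted_scale q H)"
  unfolding graded_subgroup_def graded_subset_def
proof (intro conjI allI)
  fix g g'
  have b: "0 \<le> q * H g" for g
    using graded_subgroup_ge_0[OF assms(1)] assms(2) by simp_all
  show "0 \<le> dotted_scale q H g" "dotted_scale q H g \<le> 1" using b[of g] by (auto simp: dotted_scale_def)
  show "dotted_scale q H 0 = 0" using graded_subgroup_0[OF assms(1)] by (simp add: dotted_scale_def)
  show "dotted_scale q H g = dotted_scale q H (- g)"
    by (simp only: dotted_scale_def graded_subgroup_minus[OF assms(1)])
  have "q * H (g + g') \<le> q * H g + q * H g'"
    using graded_subgroup_add[OF assms(1), of g g'] assms(2)
    by (metis distrib_left less_imp_le mult_left_mono)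
  then show "dotted_scale q H (g + g') \<le> dotted_scale q H g + dotted_scale q H g'"
    using b[of g] b[of g'] unfolding dotted_scale_def by linarith
qed

text \<open>The one-sided inequality at g and at the inverse of g gives a two-sided Lipschitz
  estimate. In this form it is stable under complements and differences.\<close>

lemma graded_invariant_iff:
  assumes "is_action act" "graded_subgroup H" "graded_subset \<phi>"
  shows "graded_invariant act H \<phi> \<longleftrightarrow> (\<forall>g x. \<bar>\<phi> (act g x) - \<phi> x\<bar> \<le> H g)"
proof
  assume L: "graded_invariant act H \<phi>"
  show "\<forall>g x. \<bar>\<phi> (act g x) - \<phi> x\<bar> \<le> H g"
  proof (intro allI)
    fix g x
    have "act (- g) (act g x) = x" using assms(1) unfolding is_action_def by (metis left_minus)
    then have "\<phi> x \<le> dotted_add (\<phi> (act g x)) (H (- g))"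
      using L unfolding graded_invariant_def by metis
    moreover have "\<phi> (act g x) \<le> dotted_add (\<phi> x) (H g)" using L unfolding graded_invariant_def by blast
    ultimately show "\<bar>\<phi> (act g x) - \<phi> x\<bar> \<le> H g"
      unfolding graded_subgroup_minus[OF assms(2)] dotted_add_def by linarith
  qed
next
  assume R: "\<forall>g x. \<bar>\<phi> (act g x) - \<phi> x\<bar> \<le> H g"
  have "\<phi> (act g x) \<le> dotted_add (\<phi> x) (H g)" for g x
  proof -
    have "\<bar>\<phi> (act g x) - \<phi> x\<bar> \<le> H g" using R by blast
    moreover have "\<phi> (act g x) \<le> 1" using assms(3) unfolding graded_subset_def by blast
    ultimately show ?thesis unfolding dotted_add_def by linarith
  qed
  then show "graded_invariant act H \<phi>" unfolding graded_invariant_def by blast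
qed

section \<open>Countable bases of sublevel sets\<close>

definition basic_sublevels :: "('z \<Rightarrow> real) set \<Rightarrow> 'z set set" where
  "basic_sublevels \<U> = {sub_less \<phi> r |\<phi> r. \<phi> \<in> \<U> \<and> r \<in> \<rat> \<and> 0 < r \<and> r < 1}"

lemma countable_basic_sublevels:
  assumes "countable \<U>" shows "countable (basic_sublevels \<U>)"
proof -
  have "basic_sublevels \<U> \<subseteq> (\<lambda>(\<phi>, r). sub_less \<phi> r) ` (\<U> \<times> \<rat>)" unfolding basic_sublevels_def by auto
  then show ?thesis using assms countable_rat by (meson countable_SIGMA countable_image countable_subset)
qed

lemma graded_basis_sublevels:
  assumes "graded_basis T \<U>"
  shows "V \<in> basic_sublevels \<U> \<Longrightarrow> openin T V"
    and "openin T U \<Longrightarrow> x \<in> U \<Longrightarrow> \<exists>V\<in>basic_sublevels \<U>. x \<in> V \<and> V \<subseteq> U"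
proof -
  have "openin T = arbitrary union_of (\<lambda>U. U \<in> basic_sublevels \<U>)"
    using assms unfolding graded_basis_def is_basis_def basic_sublevels_def by blast
  then show "V \<in> basic_sublevels \<U> \<Longrightarrow> openin T V"
    "openin T U \<Longrightarrow> x \<in> U \<Longrightarrow> \<exists>V\<in>basic_sublevels \<U>. x \<in> V \<and> V \<subseteq> U"
    unfolding openin_topology_base_unique by blast+
qed

lemma graded_basis_Union:
  assumes "graded_basis T \<U>" "openin T U"
  shows "U = \<Union>{V \<in> basic_sublevels \<U>. V \<subseteq> U}"
  using graded_basis_sublevels(2)[OF assms] by blast

lemma graded_generated_mono:
  assumes "\<B> \<subseteq> \<A>" "openin (graded_generated_topology \<B>) U"
  shows "openin (graded_generated_topology \<A>) U"
proof (rule generate_topology_on_coarsest[OF istopology_openin])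
  show "generate_topology_on (insert UNIV {sub_less \<phi> r |\<phi> r. \<phi> \<in> \<B>}) U"
    using assms(2) unfolding graded_generated_topology_def openin_topology_generated_by_iff .
  fix S assume "S \<in> insert UNIV {sub_less \<phi> r |\<phi> r. \<phi> \<in> \<B>}"
  then consider "S = UNIV" | \<phi> r where "\<phi> \<in> \<B>" "S = sub_less \<phi> r" by blast
  then show "openin (graded_generated_topology \<A>) S"
  proof cases
    case 1
    then show ?thesis using openin_topspace[of "graded_generated_topology \<A>"] by simp
  next
    case 2
    then show ?thesis using assms(1) by (auto intro: graded_generated_openin)
  qed
qed

definition invariant_part ::
    "('g::group_add \<Rightarrow> 'x \<Rightarrow> 'x) \<Rightarrow> ('g \<Rightarrow> real) set \<Rightarrow> ('x \<Rightarrow> real) set \<Rightarrow> ('x \<Rightarrow> real) set" where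
  "invariant_part act \<R> A = {\<phi> \<in> A. \<exists>H\<in>\<R>. graded_subgroup H \<and> graded_invariant act H \<phi>}"

section \<open>The invariant part of a closed family and its topology\<close>

locale graded_coset_basis =
  fixes \<R> :: "('g::{polish_space, topological_group_add} \<Rightarrow> real) set"
    and act :: "'g \<Rightarrow> 'x \<Rightarrow> 'x"
    and A :: "('x \<Rightarrow> real) set"
  assumes R_countable: "countable \<R>"
    and R_basis: "graded_basis euclidean \<R>"
    and R_cosets: "\<And>\<rho>. \<rho> \<in> \<R> \<Longrightarrow>
          \<exists>H\<in>\<R>. \<exists>g. graded_subgroup H \<and> open_graded_subset euclidean H \<and> \<rho> = graded_coset H g"
    and R_max: "\<And>H K. \<lbrakk>H \<in> \<R>; K \<in> \<R>; graded_subgroup H; graded_subgroup K\<rbrakk> \<Longrightarrow>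
          (\<lambda>g. max (H g) (K g)) \<in> \<R>"
    and R_scale: "\<And>H q. \<lbrakk>H \<in> \<R>; graded_subgroup H; q \<in> \<rat>; 0 < q\<rbrakk> \<Longrightarrow> dotted_scale q H \<in> \<R>"
    and R_conjugate: "\<And>H g. \<lbrakk>H \<in> \<R>; graded_subgroup H; graded_coset H g \<in> \<R>\<rbrakk> \<Longrightarrow>
          graded_conjugate H g \<in> \<R>"
    and action: "is_action act"
    and A_countable: "countable A"
    and A_closed: "closed_family act \<R> A"
begin

abbreviation "B \<equiv> invariant_part act \<R> A"

abbreviation "tA \<equiv> graded_generated_topology A"

abbreviation "tB \<equiv> graded_generated_topology B"

lemma B_subset: "B \<subseteq> A"
  unfolding invariant_part_def by blast

lemma R_open: "\<rho> \<in> \<R> \<Longrightarrow> open_graded_subset euclidean \<rho>"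
  using R_basis unfolding graded_basis_def by blast

lemma A_graded: "\<phi> \<in> A \<Longrightarrow> graded_subset \<phi>"
  using A_closed unfolding closed_family_def by blast

lemma B_I:
  assumes "\<phi> \<in> A" "H \<in> \<R>" "graded_subgroup H" "\<And>g x. \<bar>\<phi> (act g x) - \<phi> x\<bar> \<le> H g"
  shows "\<phi> \<in> B"
proof -
  have "graded_invariant act H \<phi>"
    unfolding graded_invariant_iff[OF action assms(3) A_graded[OF assms(1)]] using assms(4) by blast
  then show ?thesis unfolding invariant_part_def using assms(1-3) by blast
qed

lemma B_E:
  assumes "\<phi> \<in> B"
  obtains H where "H \<in> \<R>" "graded_subgroup H" "\<And>g x. \<bar>\<phi> (act g x) - \<phi> x\<bar> \<le> H g"
proof -
  obtain H where H: "\<phi> \<in> A" "H \<in> \<R>" "graded_subgroup H" "graded_invariant act H \<phi>"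
    using assms unfolding invariant_part_def by blast
  then have "\<forall>g x. \<bar>\<phi> (act g x) - \<phi> x\<bar> \<le> H g"
    using graded_invariant_iff[OF action H(3) A_graded[OF H(1)]] by blast
  then show thesis using that[OF H(2,3)] by blast
qed

lemma delta_in_B:
  assumes "\<phi> \<in> A" "\<rho> \<in> \<R>"
  shows "vaught_delta act \<rho> \<phi> \<in> B"
proof -
  obtain H g where H: "H \<in> \<R>" "graded_subgroup H" "\<rho> = graded_coset H g"
    using R_cosets[OF assms(2)] by blast
  have "graded_invariant act (graded_conjugate H g) (vaught_delta act \<rho> \<phi>)"
    using vaught_delta_invariant[OF action H(2)] R_open[OF assms(2)] unfolding H(3) by blast
  moreover have "graded_conjugate H g \<in> \<R>" using R_conjugate[OF H(1,2)] assms(2) unfolding H(3) by blast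
  ultimately show ?thesis
    unfolding invariant_part_def
    using closed_family_delta[OF A_closed assms] graded_conjugate_subgroup[OF H(2)] by blast
qed

lemma subgroup_exists: "\<exists>H\<in>\<R>. graded_subgroup H"
proof -
  have "\<exists>V\<in>basic_sublevels \<R>. (0::'g) \<in> V \<and> V \<subseteq> UNIV"
    by (rule graded_basis_sublevels(2)[OF R_basis]) simp_all
  then obtain \<rho> where "\<rho> \<in> \<R>" unfolding basic_sublevels_def by blast
  then show ?thesis using R_cosets by blast
qed

lemma B_closed: "closed_family act \<R> B"
  unfolding closed_family_def
proof (intro conjI ballI impI)
  obtain H where H: "H \<in> \<R>" "graded_subgroup H" using subgroup_exists by blast
  have "(\<lambda>x. 0) \<in> B"
    by (rule B_I[OF _ H]) (simp_all add: closed_family_const[OF A_closed] graded_subgroup_ge_0[OF H(2)])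
  then show "B \<noteq> {}" by blast
next
  fix \<phi> assume \<phi>: "\<phi> \<in> B"
  then have \<phi>A: "\<phi> \<in> A" using B_subset by blast
  show "graded_subset \<phi>" using \<phi>A by (rule A_graded)
  obtain H where H: "H \<in> \<R>" "graded_subgroup H" "\<And>g x. \<bar>\<phi> (act g x) - \<phi> x\<bar> \<le> H g"
    using \<phi> by (rule B_E) blast
  show "(\<lambda>x. 1 - \<phi> x) \<in> B"
  proof (rule B_I[OF _ H(1,2)])
    show "\<bar>1 - \<phi> (act g x) - (1 - \<phi> x)\<bar> \<le> H g" for g x using H(3)[of g x] by linarith
  qed (rule closed_family_neg[OF A_closed \<phi>A])
  show "vaught_delta act \<rho> \<phi> \<in> B" if "\<rho> \<in> \<R>" for \<rho> using \<phi>A that by (rule delta_in_B)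
  show "dotted_scale q \<phi> \<in> B" if q: "q \<in> \<rat>" "0 < q" for q
  proof (rule B_I[OF _ R_scale[OF H(1,2) q] graded_subgroup_scale[OF H(2) q(2)]])
    show "dotted_scale q \<phi> \<in> A" using \<phi>A q by (rule closed_family_scale[OF A_closed])
    fix g x
    have "\<bar>q * \<phi> (act g x) - q * \<phi> x\<bar> \<le> q * H g"
      using H(3)[of g x] q(2) by (simp add: right_diff_distrib[symmetric] abs_mult)
    moreover have "0 \<le> q * \<phi> x" "0 \<le> q * \<phi> (act g x)"
      using q(2) closed_family_bounds(1)[OF A_closed \<phi>A] by simp_all
    ultimately show "\<bar>dotted_scale q \<phi> (act g x) - dotted_scale q \<phi> x\<bar> \<le> dotted_scale q H g"
      unfolding dotted_scale_def by linarith
  qed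
  fix \<psi> assume \<psi>: "\<psi> \<in> B"
  then have \<psi>A: "\<psi> \<in> A" using B_subset by blast
  obtain K where K: "K \<in> \<R>" "graded_subgroup K" "\<And>g x. \<bar>\<psi> (act g x) - \<psi> x\<bar> \<le> K g"
    using \<psi> by (rule B_E) blast
  \<comment> \<open>A difference varies by at most \<open>H g + K g\<close>, which is bounded by
    twice the maximum; truncation at 1 is harmless for values in the unit interval.\<close>
  let ?L = "dotted_scale 2 (\<lambda>g. max (H g) (K g))"
  show "(\<lambda>x. dotted_diff (\<phi> x) (\<psi> x)) \<in> B"
  proof (rule B_I)
    show "?L \<in> \<R>" by (intro R_scale R_max graded_subgroup_max H K) auto
    show "graded_subgroup ?L" by (intro graded_subgroup_scale graded_subgroup_max H K) auto
    show "(\<lambda>x. dotted_diff (\<phi> x) (\<psi> x)) \<in> A" by (rule closed_family_diff[OF A_closed \<phi>A \<psi>A])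
    fix g x
    show "\<bar>dotted_diff (\<phi> (act g x)) (\<psi> (act g x)) - dotted_diff (\<phi> x) (\<psi> x)\<bar> \<le> ?L g"
      using H(3)[of g x] K(3)[of g x] closed_family_bounds[OF A_closed \<phi>A, of x]
        closed_family_bounds[OF A_closed \<psi>A, of x] closed_family_bounds[OF A_closed \<phi>A, of "act g x"]
        closed_family_bounds[OF A_closed \<psi>A, of "act g x"]
      unfolding dotted_diff_def dotted_scale_def by (simp only: abs_le_iff min_def max_def split: if_split) linarith
  qed
qed

text \<open>Replacing \<open>\<phi>\<close> by the steep ramp \<open>\<psi> = n (\<phi> - c)\<close>, whose level sets \<open>\<psi> = 0\<close> and \<open>\<psi> < 1\<close> are sandwiched
  between sublevel sets of \<open>\<phi>\<close>, makes the group grade the only contribution to \<open>\<psi>\<^sup>\<Delta>\<close> that matters.\<close>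

lemma vaught_set_sublevel_open:
  assumes \<phi>: "\<phi> \<in> A" and \<rho>: "\<rho> \<in> \<R>" and s: "s \<le> 1"
  shows "openin tB (vaught_set act (sub_less \<rho> s) (sub_less \<phi> r))"
proof (subst openin_subopen, intro ballI)
  fix x assume x: "x \<in> vaught_set act (sub_less \<rho> s) (sub_less \<phi> r)"
  have U: "sub_less \<theta> u = \<Union>(sub_less \<theta> ` {v \<in> \<rat>. v < u})" for \<theta> :: "'z \<Rightarrow> real" and u
  proof
    show "sub_less \<theta> u \<subseteq> \<Union>(sub_less \<theta> ` {v \<in> \<rat>. v < u})"
    proof
      fix z assume "z \<in> sub_less \<theta> u"
      then obtain v where "v \<in> \<rat>" "\<theta> z < v" "v < u" using Rats_dense_in_real unfolding sub_less_def by blast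
      then show "z \<in> \<Union>(sub_less \<theta> ` {v \<in> \<rat>. v < u})" unfolding sub_less_def by blast
    qed
  qed (auto simp: sub_less_def)
  have c: "countable (sub_less \<theta> ` {v \<in> \<rat>. v < u})" for \<theta> :: "'z \<Rightarrow> real" and u
    by (intro countable_image countable_subset[OF _ countable_rat]) auto
  \<comment> \<open>Non-meagreness survives lowering both thresholds to suitable rationals. The gap
    r - r' leaves room for the ramp, the gap s - s' for the grade that the transform adds.\<close>
  have "x \<in> (\<Union>U\<in>sub_less \<rho> ` {v \<in> \<rat>. v < s}. \<Union>V\<in>sub_less \<phi> ` {v \<in> \<rat>. v < r}. vaught_set act U V)"
    using x unfolding vaught_set_Union[OF c c, symmetric] U[symmetric] .
  then obtain s' r' where sr: "s' \<in> \<rat>" "s' < s" "r' \<in> \<rat>" "r' < r"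
      and x': "x \<in> vaught_set act (sub_less \<rho> s') (sub_less \<phi> r')" by auto
  obtain h where h: "h \<in> sub_less \<rho> s'" "act h x \<in> sub_less \<phi> r'" using x' by (rule vaught_set_nonempty)
  have "0 < s'" using h(1) R_open[OF \<rho>]
    by (auto simp: open_graded_subset_def graded_subset_def sub_less_def intro: le_less_trans)
  have "0 < r'" using h(2) closed_family_bounds(1)[OF A_closed \<phi>]
    by (auto simp: sub_less_def intro: le_less_trans)
  \<comment> \<open>The rational constants of \<open>A\<close> lie in the unit interval. As \<phi>
    is at most 1, \<open>\<phi> \<le> c\<close> still holds on \<open>sub_less \<phi> r'\<close>
    after capping.\<close>
  define c where "c = min r' 1"
  have c01: "c \<in> \<rat>" "0 \<le> c" "c \<le> 1" "c \<le> r'" using \<open>0 < r'\<close> sr(3) by (auto simp: c_def min_def)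
  \<comment> \<open>The slope n + 1 exceeds 1/(r - r'), so \<psi> < 1 forces \<phi> < r.\<close>
  obtain n :: nat where n: "inverse (real (Suc n)) < r - r'" using reals_Archimedean[of "r - r'"] sr(4) by auto
  let ?N = "real (Suc n)"
  define \<psi> where "\<psi> = dotted_scale ?N (\<lambda>x. dotted_diff (\<phi> x) c)"
  have \<psi>A: "\<psi> \<in> A"
    unfolding \<psi>_def using c01
    by (intro closed_family_scale[OF A_closed] closed_family_diff[OF A_closed \<phi>] closed_family_const[OF A_closed]) auto
  let ?T = "sub_less (vaught_delta act \<rho> \<psi>) s"
  have "openin tB ?T" by (rule graded_generated_openin[OF delta_in_B[OF \<psi>A \<rho>]])
  moreover have "x \<in> ?T"
  proof -
    \<comment> \<open>\<psi> vanishes on \<open>sub_less \<phi> r'\<close>, so every positive u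
      works as its threshold; half of the gap keeps u + s' below s.\<close>
    define u where "u = (s - s') / 2"
    have u: "0 < u" "u \<le> 1" "u + s' < s" using sr(2) \<open>0 < s'\<close> s unfolding u_def by (auto simp: field_simps)
    have "sub_less \<phi> r' \<subseteq> sub_less \<psi> u"
    proof
      fix y assume "y \<in> sub_less \<phi> r'"
      then have "\<phi> y \<le> c" using closed_family_bounds(2)[OF A_closed \<phi>, of y] by (simp add: c_def sub_less_def)
      then have "\<psi> y = 0" by (simp add: \<psi>_def dotted_scale_def dotted_diff_def)
      then show "y \<in> sub_less \<psi> u" using u(1) by (simp add: sub_less_def)
    qed
    then have "x \<in> vaught_set act (sub_less \<rho> s') (sub_less \<psi> u)"
      using x' vaught_set_mono[OF order_refl] by blast
    then have "vaught_delta act \<rho> \<psi> x < s"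
      using u \<open>0 < s'\<close> sr(2) s
      by (intro vaught_delta_less_iff[OF R_open[OF \<rho>] s, THEN iffD2] exI[of _ u] exI[of _ s']) auto
    then show ?thesis by (simp add: sub_less_def)
  qed
  moreover have "?T \<subseteq> vaught_set act (sub_less \<rho> s) (sub_less \<phi> r)"
  proof
    fix y assume "y \<in> ?T"
    then have "vaught_delta act \<rho> \<psi> y < s" by (simp add: sub_less_def)
    then obtain u v where uv: "u \<in> {0..1}" "v \<in> {0..1}" "u + v < s"
        "y \<in> vaught_set act (sub_less \<rho> v) (sub_less \<psi> u)"
      using vaught_delta_less_iff[OF R_open[OF \<rho>] s, of act \<psi> y] by blast
    have "sub_less \<rho> v \<subseteq> sub_less \<rho> s" using uv by (auto simp: sub_less_def)
    moreover have "sub_less \<psi> u \<subseteq> sub_less \<phi> r"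
    proof
      fix z assume "z \<in> sub_less \<psi> u"
      then have "min (?N * dotted_diff (\<phi> z) c) 1 < 1"
        using uv(1) by (auto simp: sub_less_def \<psi>_def dotted_scale_def)
      then have "?N * dotted_diff (\<phi> z) c < 1" by (simp add: min_less_iff_disj)
      then have "dotted_diff (\<phi> z) c < inverse ?N" by (simp add: field_simps)
      then have "\<phi> z < r" using n c01(4) unfolding dotted_diff_def by linarith
      then show "z \<in> sub_less \<phi> r" by (simp add: sub_less_def)
    qed
    ultimately show "y \<in> vaught_set act (sub_less \<rho> s) (sub_less \<phi> r)"
      using uv(4) vaught_set_mono by blast
  qed
  ultimately show "\<exists>T. openin tB T \<and> x \<in> T \<and> T \<subseteq> vaught_set act (sub_less \<rho> s) (sub_less \<phi> r)"
    by (intro exI[of _ ?T] conjI)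
qed

lemma A_graded_basis: "graded_basis tA A"
  by (rule closed_family_graded_basis[OF A_closed])

lemma B_graded_basis: "graded_basis tB B"
  by (rule closed_family_graded_basis[OF B_closed])

text \<open>Both open sets are countable unions of basic sublevel sets, because \<open>\<R>\<close>
  and \<open>A\<close> are countable, and transforms commute with such unions.\<close>

lemma vaught_set_open:
  assumes U: "open U" and V: "openin tA V"
  shows "openin tB (vaught_set act U V)"
proof -
  let ?U = "{U' \<in> basic_sublevels \<R>. U' \<subseteq> U}" and ?V = "{V' \<in> basic_sublevels A. V' \<subseteq> V}"
  have "\<Union>?U = U" by (rule graded_basis_Union[OF R_basis, symmetric]) (use U in simp)
  moreover have "\<Union>?V = V" by (rule graded_basis_Union[OF A_graded_basis V, symmetric])
  moreover have "countable ?U" "countable ?V"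
    using countable_basic_sublevels[OF R_countable] countable_basic_sublevels[OF A_countable]
    by simp_all
  ultimately have eq: "vaught_set act U V = (\<Union>U'\<in>?U. \<Union>V'\<in>?V. vaught_set act U' V')"
    using vaught_set_Union[of ?U ?V act] by (simp only:)
  have "openin tB (vaught_set act U' V')" if U': "U' \<in> ?U" and V': "V' \<in> ?V" for U' V'
  proof -
    obtain \<rho> s where 1: "\<rho> \<in> \<R>" "s < 1" "U' = sub_less \<rho> s" using U' unfolding basic_sublevels_def by blast
    obtain \<phi> r where 2: "\<phi> \<in> A" "V' = sub_less \<phi> r" using V' unfolding basic_sublevels_def by blast
    show ?thesis unfolding 1(3) 2(2) using 1(2) by (intro vaught_set_sublevel_open 1(1) 2(1)) simp
  qed
  then show ?thesis unfolding eq by (intro openin_Union) blast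
qed

text \<open>If \<phi> is H-invariant, \<phi>(gx) and \<phi>(hx) differ by at most H(g h^-1),
  uniformly in x. Hence a bound on \<phi>(hx) for a single h near g0 gives one for all g near g0,
  and a transform serves as the required neighbourhood of x0.\<close>

lemma action_continuous: "continuous_action act tB"
proof -
  let ?f = "\<lambda>(g, x). act g x"
  have open_subgroup: "open {h. H (h + - g) < \<epsilon>}" if "H \<in> \<R>" for H and g :: 'g and \<epsilon> :: real
  proof -
    have "{h. H (h + - g) < \<epsilon>} = (\<lambda>h. h + - g) -` sub_less H \<epsilon>" by (auto simp: sub_less_def)
    moreover have "open ((\<lambda>h. h + - g) -` sub_less H \<epsilon>)"
      by (rule open_vimage[OF open_sub_less[OF R_open[OF that]]]) (intro continuous_intros)
    ultimately show ?thesis by simp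
  qed
  have main: "openin (prod_topology euclidean tB) {p. ?f p \<in> sub_less \<phi> r}" if \<phi>: "\<phi> \<in> B" for \<phi> r
    unfolding openin_prod_topology_alt
  proof (intro allI impI)
    fix g0 x0 assume "(g0, x0) \<in> {p. ?f p \<in> sub_less \<phi> r}"
    then have less: "\<phi> (act g0 x0) < r" by (simp add: sub_less_def)
    obtain H where H: "H \<in> \<R>" "graded_subgroup H" "\<And>g x. \<bar>\<phi> (act g x) - \<phi> x\<bar> \<le> H g"
      using \<phi> by (rule B_E) blast
    have shift: "\<bar>\<phi> (act g x) - \<phi> (act h x)\<bar> \<le> H (g + - h)" for g h x
    proof -
      have "act (g + - h) (act h x) = act g x"
        using action unfolding is_action_def by (metis add.assoc add.right_neutral left_minus)
      then show ?thesis using H(3)[of "g + - h" "act h x"] by simp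
    qed
    \<comment> \<open>The gap is spent as follows: 2\<epsilon> on the level used in
      \<open>?W\<close>, and \<epsilon> on each of the moves from h to g0 and from g0 to g.\<close>
    define \<epsilon> where "\<epsilon> = (r - \<phi> (act g0 x0)) / 4"
    have \<epsilon>: "0 < \<epsilon>" using less by (simp add: \<epsilon>_def)
    have "4 * (a / 4) = a" for a :: real by simp
    then have "4 * \<epsilon> = r - \<phi> (act g0 x0)" unfolding \<epsilon>_def .
    then have \<epsilon>_eq: "\<phi> (act g0 x0) + 4 * \<epsilon> = r" by simp
    let ?N = "{h. H (h + - g0) < \<epsilon>}"
    let ?W = "vaught_set act ?N (sub_less \<phi> (\<phi> (act g0 x0) + 2 * \<epsilon>))"
    have N: "open ?N" "g0 \<in> ?N" using open_subgroup[OF H(1)] \<epsilon> graded_subgroup_0[OF H(2)] by auto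
    have "openin tB ?W"
    proof (rule vaught_set_open[OF N(1)])
      show "openin tA (sub_less \<phi> (\<phi> (act g0 x0) + 2 * \<epsilon>))"
        using \<phi> B_subset by (intro graded_generated_openin) blast
    qed
    moreover have "x0 \<in> ?W"
    proof (rule vaught_set_openI[OF N order_refl])
      fix h assume "h \<in> ?N"
      then show "act h x0 \<in> sub_less \<phi> (\<phi> (act g0 x0) + 2 * \<epsilon>)"
        using shift[of h x0 g0] \<epsilon> by (simp add: sub_less_def)
    qed
    moreover have "?N \<times> ?W \<subseteq> {p. ?f p \<in> sub_less \<phi> r}"
    proof
      fix p assume "p \<in> ?N \<times> ?W"
      then obtain g x where p: "p = (g, x)" "g \<in> ?N" "x \<in> ?W" by blast
      obtain h where h: "h \<in> ?N" "act h x \<in> sub_less \<phi> (\<phi> (act g0 x0) + 2 * \<epsilon>)"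
        using p(3) by (rule vaught_set_nonempty)
      have "\<bar>\<phi> (act g x) - \<phi> (act g0 x)\<bar> < \<epsilon>" "\<bar>\<phi> (act h x) - \<phi> (act g0 x)\<bar> < \<epsilon>"
        using shift[of g x g0] shift[of h x g0] p(2) h(1) by auto
      then have "\<phi> (act g x) < r" using h(2) \<epsilon>_eq unfolding sub_less_def mem_Collect_eq by linarith
      then show "p \<in> {p. ?f p \<in> sub_less \<phi> r}" by (simp add: p(1) sub_less_def)
    qed
    ultimately show "\<exists>U V. openin euclidean U \<and> openin tB V \<and> g0 \<in> U \<and> x0 \<in> V \<and>
        U \<times> V \<subseteq> {p. ?f p \<in> sub_less \<phi> r}"
      using N by (intro exI[of _ ?N] exI[of _ ?W]) simp
  qed
  have top: "topspace (prod_topology euclidean tB) = UNIV" by simp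
  show ?thesis
    unfolding continuous_action_def graded_generated_topology_def[of B]
  proof (rule continuous_on_generated_topo, fold graded_generated_topology_def[of B])
    fix S assume "S \<in> insert UNIV {sub_less \<phi> r |\<phi> r. \<phi> \<in> B}"
    then consider "S = UNIV" | \<phi> r where "\<phi> \<in> B" "S = sub_less \<phi> r" by blast
    then show "openin (prod_topology euclidean tB) (?f -` S \<inter> topspace (prod_topology euclidean tB))"
    proof cases
      case 1
      then show ?thesis using openin_topspace[of "prod_topology euclidean tB"] by simp
    next
      case 2
      then show ?thesis using main[OF 2(1), of r] by (simp only: top Int_UNIV_right vimage_def)
    qed
  qed simp
qed

end

section \<open>The topology of the invariant members is Polish\<close>

context graded_coset_basis
begin

text \<open>U and V are countable unions of basic sets of small diameter, and one pair of pieces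
  must already witness non-meagreness.\<close>

lemma vaught_set_refine:
  assumes d: "Metric_space UNIV d" "tA = Metric_space.mtopology UNIV d"
    and U: "open U" and V: "openin tA V" and x: "x \<in> vaught_set act U V" and \<epsilon>: "0 < \<epsilon>"
  shows "\<exists>U'\<in>basic_sublevels \<R>. \<exists>V'\<in>basic_sublevels A. x \<in> vaught_set act U' V' \<and> U' \<subseteq> U \<and> V' \<subseteq> V \<and>
    (\<forall>a\<in>U'. \<forall>b\<in>U'. dist a b < \<epsilon>) \<and> (\<forall>a\<in>V'. \<forall>b\<in>V'. d a b < \<epsilon>)"
proof -
  interpret M: Metric_space UNIV d by (rule d(1))
  let ?U = "{U' \<in> basic_sublevels \<R>. U' \<subseteq> U \<and> (\<forall>a\<in>U'. \<forall>b\<in>U'. dist a b < \<epsilon>)}"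
  let ?V = "{V' \<in> basic_sublevels A. V' \<subseteq> V \<and> (\<forall>a\<in>V'. \<forall>b\<in>V'. d a b < \<epsilon>)}"
  have "\<Union>?U = U"
  proof
    show "U \<subseteq> \<Union>?U"
    proof
      fix h assume h: "h \<in> U"
      have "openin euclidean (U \<inter> ball h (\<epsilon>/2))" using U by (simp add: open_Int)
      moreover have "h \<in> U \<inter> ball h (\<epsilon>/2)" using h \<epsilon> by simp
      ultimately obtain U' where U': "U' \<in> basic_sublevels \<R>" "h \<in> U'" "U' \<subseteq> U \<inter> ball h (\<epsilon>/2)"
        using graded_basis_sublevels(2)[OF R_basis] by blast
      have "dist a b < \<epsilon>" if "a \<in> U'" "b \<in> U'" for a b
      proof -
        have "dist h a < \<epsilon>/2" "dist h b < \<epsilon>/2" using subsetD[OF U'(3) that(1)] subsetD[OF U'(3) that(2)] by simp_all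
        then show ?thesis by (rule dist_triangle_half_r)
      qed
      then have "U' \<in> ?U" using U' by simp
      then show "h \<in> \<Union>?U" using U'(2) by (rule UnionI)
    qed
  qed blast
  moreover have "\<Union>?V = V"
  proof
    show "V \<subseteq> \<Union>?V"
    proof
      fix z assume z: "z \<in> V"
      have "openin tA (V \<inter> M.mball z (\<epsilon>/2))"
        using V unfolding d(2) by (intro openin_Int M.openin_mball)
      moreover have "z \<in> V \<inter> M.mball z (\<epsilon>/2)" using z \<epsilon> by simp
      ultimately obtain V' where V': "V' \<in> basic_sublevels A" "z \<in> V'" "V' \<subseteq> V \<inter> M.mball z (\<epsilon>/2)"
        using graded_basis_sublevels(2)[OF A_graded_basis] by blast
      have "d a b < \<epsilon>" if "a \<in> V'" "b \<in> V'" for a b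
      proof -
        have "d z a < \<epsilon>/2" "d z b < \<epsilon>/2" using subsetD[OF V'(3) that(1)] subsetD[OF V'(3) that(2)] by simp_all
        moreover have "d a b \<le> d z a + d z b" using M.triangle[of a z b] M.commute[of a z] by simp
        ultimately show ?thesis by linarith
      qed
      then have "V' \<in> ?V" using V' by simp
      then show "z \<in> \<Union>?V" using V'(2) by (rule UnionI)
    qed
  qed blast
  moreover have "countable ?U" "countable ?V"
    using countable_basic_sublevels[OF R_countable] countable_basic_sublevels[OF A_countable]
    by simp_all
  ultimately have "vaught_set act U V = (\<Union>U'\<in>?U. \<Union>V'\<in>?V. vaught_set act U' V')"
    using vaught_set_Union[of ?U ?V act] by (simp only:)
  then obtain U' V' where "U' \<in> ?U" "V' \<in> ?V" "x \<in> vaught_set act U' V'" using x by blast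
  then show ?thesis by (intro bexI[of _ U'] bexI[of _ V']) simp_all
qed

text \<open>Points of the closure of the image of \<open>X\<close> in \<open>\<real>\<^sup>\<nat>\<close> cannot be acted on, but the transforms
  \<open>V\<^sup>\<Delta>\<^sup>U\<close> extend to open sets \<open>W(U,V)\<close> there. If membership in each \<open>W(U,V)\<close> can always be refined to
  arbitrarily small \<open>U'\<close>, \<open>V'\<close>, a \<open>G\<^sub>\<delta>\<close> condition, then one gets convergent sequences
  \<open>g\<^sub>n \<rightarrow> g\<close> and \<open>g\<^sub>n x\<^sub>n \<rightarrow> z\<close>, and joint continuity gives \<open>x\<^sub>n \<rightarrow> g\<^sup>-\<^sup>1 z \<in> X\<close>.\<close>

lemma B_completely_metrizable:
  assumes complete: "completely_metrizable_space tA" and hausdorff: "Hausdorff_space tB"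
  shows "completely_metrizable_space tB"
proof -
  obtain M d where Md: "Metric_space M d" "Metric_space.mcomplete M d" "tA = Metric_space.mtopology M d"
    using complete unfolding completely_metrizable_space_def by blast
  have "M = UNIV" using graded_generated_topspace[of A] Metric_space.topspace_mtopology[OF Md(1)] Md(3) by simp
  then have d: "Metric_space UNIV d" "Metric_space.mcomplete UNIV d" "tA = Metric_space.mtopology UNIV d"
    using Md by simp_all
  interpret M: Metric_space UNIV d by (rule d(1))
  have Bne: "B \<noteq> {}" using B_closed unfolding closed_family_def by blast
  have Bc: "countable B" by (rule countable_subset[OF B_subset A_countable])
  define f where "f = from_nat_into B"
  have f: "range f = B" unfolding f_def by (rule range_from_nat_into[OF Bne Bc])
  define e where "e = (\<lambda>x n. f n x)"
  have econt: "continuous_map tB euclidean e"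
  proof -
    have "continuous_map tB (product_topology (\<lambda>_. euclideanreal) UNIV) e"
      unfolding e_def continuous_map_componentwise_UNIV
    proof
      fix n
      have "f n \<in> B" using f by blast
      then show "continuous_map tB euclideanreal (f n)"
        by (intro continuous_map_graded_generated closed_family_neg[OF B_closed])
    qed
    then show ?thesis by (simp only: euclidean_product_topology)
  qed
  have pull: "openin tB U \<longleftrightarrow> (\<exists>V. open V \<and> U = e -` V)" for U
  proof
    assume "openin tB U"
    then have "\<exists>V. openin euclidean V \<and> U = e -` V"
      unfolding graded_generated_topology_def
    proof (rule openin_pullback_of_subbasis)
      fix S assume "S \<in> insert UNIV {sub_less \<phi> r |\<phi> r. \<phi> \<in> B}"
      then have "S \<in> insert UNIV {sub_less \<phi> r |\<phi> r. \<phi> \<in> range f}" by (simp only: f)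
      then consider "S = UNIV" | n r where "S = sub_less (f n) r" by blast
      then show "\<exists>V. openin euclidean V \<and> S = e -` V"
      proof cases
        case 1
        then show ?thesis by (intro exI[of _ UNIV]) simp
      next
        case 2
        have "open {\<epsilon>. \<epsilon> n < r}" by (intro open_Collect_less continuous_on_product_coordinates continuous_intros)
        then show ?thesis using 2 by (intro exI[of _ "{\<epsilon>. \<epsilon> n < r}"]) (auto simp: e_def sub_less_def)
      qed
    qed
    then show "\<exists>V. open V \<and> U = e -` V" by simp
  next
    assume "\<exists>V. open V \<and> U = e -` V"
    then show "openin tB U" using openin_continuous_map_preimage[OF econt] by (auto simp: vimage_def)
  qed
  \<comment> \<open>The open sets of \<open>tB\<close> are preimages under \<open>e\<close>, so
    points they separate have different images.\<close>
  have inj: "inj e"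
  proof (rule injI, rule ccontr)
    fix x y assume "e x = e y" "x \<noteq> y"
    then obtain U where "openin tB U" "x \<in> U" "y \<notin> U"
      using hausdorff unfolding Hausdorff_space_def disjnt_def by (metis IntI UNIV_I empty_iff graded_generated_topspace)
    then show False using \<open>e x = e y\<close> unfolding pull by auto
  qed
  define I where "I = basic_sublevels \<R> \<times> basic_sublevels A"
  have Ic: "countable I" unfolding I_def
    by (intro countable_SIGMA countable_basic_sublevels R_countable A_countable)
  have Iopen: "open (fst i)" "openin tA (snd i)" if "i \<in> I" for i
    using that graded_basis_sublevels(1)[OF R_basis] graded_basis_sublevels(1)[OF A_graded_basis]
    by (auto simp: I_def)
  have "\<forall>i\<in>I. \<exists>V. open V \<and> vaught_set act (fst i) (snd i) = e -` V"
    by (intro ballI pull[THEN iffD1] vaught_set_open Iopen)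
  then obtain W where W: "\<forall>i\<in>I. open (W i) \<and> vaught_set act (fst i) (snd i) = e -` W i"
    unfolding bchoice_iff by blast
  then have Wopen: "open (W i)" and We: "e -` W i = vaught_set act (fst i) (snd i)" if "i \<in> I" for i
    using that by simp_all
  \<comment> \<open>Only the refining pair j has to be basic, so that a refinement may start from
    the pair of whole spaces.\<close>
  define lt where "lt n j i \<longleftrightarrow> j \<in> I \<and> fst j \<subseteq> fst i \<and> snd j \<subseteq> snd i \<and>
      (\<forall>a\<in>fst j. \<forall>b\<in>fst j. dist a b < inverse (real (Suc n))) \<and>
      (\<forall>a\<in>snd j. \<forall>b\<in>snd j. d a b < inverse (real (Suc n)))" for n j i
  have refine: "\<exists>j. lt n j i \<and> e x \<in> W j"
    if "open (fst i)" "openin tA (snd i)" "x \<in> vaught_set act (fst i) (snd i)" for n i x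
  proof -
    have "0 < inverse (real (Suc n))" by simp
    from vaught_set_refine[OF d(1,3) that this] obtain U' V' where
      "U' \<in> basic_sublevels \<R>" "V' \<in> basic_sublevels A" "x \<in> vaught_set act U' V'" "U' \<subseteq> fst i" "V' \<subseteq> snd i"
      "\<forall>a\<in>U'. \<forall>b\<in>U'. dist a b < inverse (real (Suc n))" "\<forall>a\<in>V'. \<forall>b\<in>V'. d a b < inverse (real (Suc n))"
      by blast
    then have j: "lt n (U', V') i" "x \<in> vaught_set act (fst (U', V')) (snd (U', V'))"
      by (simp_all add: lt_def I_def)
    then have "(U', V') \<in> I" by (simp add: lt_def)
    then have "e x \<in> W (U', V')" using We j(2) by blast
    then show ?thesis using j(1) by blast
  qed
  \<comment> \<open>Membership in \<open>C (n, i)\<close> says that a point of \<open>W i\<close>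
    also lies in \<open>W j\<close> for some refinement j of i at scale n. It is the union of a
    closed and an open set.\<close>
  define C where "C = (\<lambda>(n, i). - W i \<union> \<Union>(W ` {j. lt n j i}))"
  \<comment> \<open>The closure supplies approximating points of the image, the second set starts a
    chain of refinements, and the third continues it at every scale.\<close>
  define D where "D = closure (range e) \<inter> \<Union>(W ` I) \<inter> \<Inter>(C ` (UNIV \<times> I))"
  have ltI: "j \<in> I" if "lt n j i" for n j i using that by (simp add: lt_def)
  have "range e \<subseteq> D"
  proof
    fix y assume "y \<in> range e"
    then obtain x where x: "y = e x" by blast
    have "y \<in> closure (range e)" using subsetD[OF closure_subset rangeI[of e x]] x by simp
    moreover have "y \<in> \<Union>(W ` I)"
    proof -
      have "x \<in> vaught_set act UNIV UNIV" by (rule vaught_set_openI[of UNIV 0]) simp_all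
      then have "\<exists>j. lt 0 j (UNIV, UNIV) \<and> e x \<in> W j"
        using openin_topspace[of tA] by (intro refine) simp_all
      then obtain j where "lt 0 j (UNIV, UNIV)" "e x \<in> W j" by (elim exE conjE)
      then show ?thesis using ltI x by (intro UN_I) simp_all
    qed
    moreover have "y \<in> C (n, i)" if "i \<in> I" for n i
    proof (cases "y \<in> W i")
      case True
      then have "x \<in> e -` W i" using x by simp
      then have "x \<in> vaught_set act (fst i) (snd i)" unfolding We[OF that] .
      from refine[OF Iopen[OF that] this, of n] obtain j where "lt n j i" "e x \<in> W j" by (elim exE conjE)
      then show ?thesis unfolding C_def prod.case x by (intro UnI2 UN_I) simp_all
    qed (simp add: C_def)
    ultimately show "y \<in> D" unfolding D_def by (intro IntI INT_I) (auto simp only:)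
  qed
  moreover have "D \<subseteq> range e"
  proof
    fix y assume "y \<in> D"
    then have ycl: "y \<in> closure (range e)" and yI: "y \<in> \<Union>(W ` I)"
      and yC: "\<And>n i. i \<in> I \<Longrightarrow> y \<in> C (n, i)" unfolding D_def by simp_all
    have step: "\<exists>j. (j \<in> I \<and> y \<in> W j) \<and> lt n j i" if "i \<in> I \<and> y \<in> W i" for n i
    proof -
      have "y \<in> - W i \<union> \<Union>(W ` {j. lt n j i})" using yC[of i n] that by (simp add: C_def)
      then have "y \<in> \<Union>(W ` {j. lt n j i})" using that by simp
      then obtain j where "lt n j i" "y \<in> W j" by (elim UN_E CollectE)
      then show ?thesis using ltI by (intro exI[of _ j]) simp
    qed
    have "\<exists>s. \<forall>n. (s n \<in> I \<and> y \<in> W (s n)) \<and> lt n (s (Suc n)) (s n)"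
      by (rule dependent_nat_choice) (use yI in \<open>simp add: Bex_def\<close>, rule step)
    then obtain s where "\<forall>n. (s n \<in> I \<and> y \<in> W (s n)) \<and> lt n (s (Suc n)) (s n)" by (rule exE)
    then have s: "\<And>n. s n \<in> I" "\<And>n. y \<in> W (s n)" "\<And>n. lt n (s (Suc n)) (s n)" by simp_all
    \<comment> \<open>No point of the space corresponds to y yet. Openness of \<open>W (s n)\<close>
      hands its membership over to an image point within 1/(n + 1) of y.\<close>
    have "\<exists>x. e x \<in> W (s n) \<and> dist (e x) y < inverse (real (Suc n))" for n
    proof -
      have "open (W (s n) \<inter> ball y (inverse (real (Suc n))))" using Wopen[OF s(1)] by blast
      moreover have "y \<in> W (s n) \<inter> ball y (inverse (real (Suc n)))" using s(2) by simp
      ultimately have "(W (s n) \<inter> ball y (inverse (real (Suc n)))) \<inter> range e \<noteq> {}"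
        using ycl open_Int_closure_eq_empty[of "W (s n) \<inter> ball y (inverse (real (Suc n)))" "range e"] by (metis IntI empty_iff)
      then obtain x where "e x \<in> W (s n)" "e x \<in> ball y (inverse (real (Suc n)))" by blast
      then show ?thesis by (intro exI[of _ x]) (simp add: dist_commute)
    qed
    then have "\<forall>n. \<exists>x. e x \<in> W (s n) \<and> dist (e x) y < inverse (real (Suc n))" by (rule allI)
    from choice[OF this] obtain x where
      "\<forall>n. e (x n) \<in> W (s n) \<and> dist (e (x n)) y < inverse (real (Suc n))" by (rule exE)
    then have x: "\<And>n. e (x n) \<in> W (s n)" "\<And>n. dist (e (x n)) y < inverse (real (Suc n))" by simp_all
    have "\<exists>g. g \<in> fst (s n) \<and> act g (x n) \<in> snd (s n)" for n
    proof -
      have "x n \<in> e -` W (s n)" using x(1) by simp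
      then have "x n \<in> vaught_set act (fst (s n)) (snd (s n))" unfolding We[OF s(1)] .
      then show ?thesis by (rule vaught_set_nonempty) blast
    qed
    then have "\<forall>n. \<exists>g. g \<in> fst (s n) \<and> act g (x n) \<in> snd (s n)" by (rule allI)
    from choice[OF this] obtain g where
      "\<forall>n. g n \<in> fst (s n) \<and> act (g n) (x n) \<in> snd (s n)" by (rule exE)
    then have g: "\<And>n. g n \<in> fst (s n)" "\<And>n. act (g n) (x n) \<in> snd (s n)" by simp_all
    let ?z = "\<lambda>n. act (g n) (x n)"
    have dec: "fst (s m) \<subseteq> fst (s n) \<and> snd (s m) \<subseteq> snd (s n)" if "n \<le> m" for n m
      using that
    proof (induction rule: dec_induct)
      case (step k)
      then show ?case using s(3)[of k] unfolding lt_def by blast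
    qed simp
    have small: "dist (g m) (g m') < inverse (real (Suc n)) \<and> d (?z m) (?z m') < inverse (real (Suc n))"
      if "Suc n \<le> m" "Suc n \<le> m'" for n m m'
    proof -
      \<comment> \<open>Scale n bounds the diameters of the refined pair \<open>s (Suc n)\<close>,
        not those of \<open>s n\<close>; hence the shift by one in the indices.\<close>
      have in_s: "g k \<in> fst (s (Suc n))" "?z k \<in> snd (s (Suc n))" if "Suc n \<le> k" for k
        using subsetD[OF conjunct1[OF dec[OF that]] g(1)] subsetD[OF conjunct2[OF dec[OF that]] g(2)] by simp_all
      have "\<forall>a\<in>fst (s (Suc n)). \<forall>b\<in>fst (s (Suc n)). dist a b < inverse (real (Suc n))"
          "\<forall>a\<in>snd (s (Suc n)). \<forall>b\<in>snd (s (Suc n)). d a b < inverse (real (Suc n))"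
        using s(3)[of n] unfolding lt_def by simp_all
      from bspec[OF bspec[OF this(1) in_s(1)[OF that(1)]] in_s(1)[OF that(2)]]
        bspec[OF bspec[OF this(2) in_s(2)[OF that(1)]] in_s(2)[OF that(2)]]
      show ?thesis by (rule conjI)
    qed
    have "Cauchy g"
    proof (rule metric_CauchyI)
      fix \<epsilon> :: real assume "0 < \<epsilon>"
      from reals_Archimedean[OF this] obtain n where n: "inverse (real (Suc n)) < \<epsilon>" by (rule exE)
      then have "dist (g m) (g m') < \<epsilon>" if "Suc n \<le> m" "Suc n \<le> m'" for m m'
        using small[OF that] n by linarith
      then show "\<exists>M. \<forall>m\<ge>M. \<forall>n\<ge>M. dist (g m) (g n) < \<epsilon>" by (intro exI[of _ "Suc n"]) simp
    qed
    then obtain h where h: "g \<longlonglongrightarrow> h" unfolding Cauchy_convergent_iff convergent_def by (rule exE)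
    have "M.MCauchy ?z"
      unfolding M.MCauchy_def
    proof (intro conjI allI impI)
      fix \<epsilon> :: real assume "0 < \<epsilon>"
      from reals_Archimedean[OF this] obtain n where n: "inverse (real (Suc n)) < \<epsilon>" by (rule exE)
      then show "\<exists>N. \<forall>n n'. N \<le> n \<longrightarrow> N \<le> n' \<longrightarrow> d (?z n) (?z n') < \<epsilon>"
      proof (intro exI[of _ "Suc n"] allI impI)
        show "d (?z m) (?z m') < \<epsilon>" if "Suc n \<le> m" "Suc n \<le> m'" for m m'
          using small[OF that] n by linarith
      qed
    qed simp
    then obtain z where "limitin tA ?z z sequentially" using d(2,3) unfolding M.mcomplete_def by auto
    \<comment> \<open>The limit exists by completeness of \<open>tA\<close> and persists in the
      coarser \<open>tB\<close>, for which the action is continuous.\<close>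
    then have "limitin tB ?z z sequentially"
      using graded_generated_mono[OF B_subset] unfolding limitin_def graded_generated_topspace by blast
    moreover have "limitin euclidean (\<lambda>n. - g n) (- h) sequentially" using tendsto_minus[OF h] by simp
    ultimately have "limitin (prod_topology euclidean tB) (\<lambda>n. (- g n, ?z n)) (- h, z) sequentially"
      by (simp add: limitin_pairwise o_def)
    from continuous_map_limit[OF action_continuous[unfolded continuous_action_def] this]
    have "limitin tB (\<lambda>n. act (- g n) (?z n)) (act (- h) z) sequentially" by (simp add: o_def)
    moreover have "act (- g n) (?z n) = x n" for n
      using action unfolding is_action_def by (metis left_minus)
    ultimately have "limitin tB x (act (- h) z) sequentially" by simp
    from continuous_map_limit[OF econt this]
    have "(\<lambda>n. e (x n)) \<longlonglongrightarrow> e (act (- h) z)" by (simp add: o_def)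
    moreover have "(\<lambda>n. e (x n)) \<longlonglongrightarrow> y"
    proof (rule metric_LIMSEQ_I)
      fix \<epsilon> :: real assume "0 < \<epsilon>"
      from reals_Archimedean[OF this] obtain N where N: "inverse (real (Suc N)) < \<epsilon>" by (rule exE)
      have "dist (e (x n)) y < \<epsilon>" if "N \<le> n" for n
      proof -
        have "inverse (real (Suc n)) \<le> inverse (real (Suc N))" using that by (intro le_imp_inverse_le) simp_all
        then show ?thesis using x(2)[of n] N by linarith
      qed
      then show "\<exists>N. \<forall>n\<ge>N. dist (e (x n)) y < \<epsilon>" by blast
    qed
    ultimately have "y = e (act (- h) z)" using LIMSEQ_unique by blast
    then show "y \<in> range e" by blast
  qed
  ultimately have "range e = D" by (rule equalityI)
  moreover have "gdelta_in euclidean D"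
  proof -
    have cl: "gdelta_in euclidean S" if "closed S" for S :: "(nat \<Rightarrow> real) set"
      using that by (simp add: closed_imp_gdelta_in metrizable_space_euclidean)
    have op: "gdelta_in euclidean S" if "open S" for S :: "(nat \<Rightarrow> real) set"
      using that by (simp add: open_imp_gdelta_in)
    have Cg: "gdelta_in euclidean (C p)" if "p \<in> UNIV \<times> I" for p
    proof -
      obtain n i where p: "p = (n, i)" "i \<in> I" using \<open>p \<in> UNIV \<times> I\<close> by blast
      have "open (\<Union>(W ` {j. lt n j i}))" using Wopen ltI by (intro open_UN) blast
      then show ?thesis unfolding C_def p(1) prod.case using Wopen[OF p(2)]
        by (intro gdelta_in_Un op cl) (simp_all add: closed_Compl)
    qed
    have "I \<noteq> {}" using \<open>range e = D\<close> unfolding D_def by blast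
    moreover have "countable (C ` (UNIV \<times> I))" using Ic by (intro countable_image countable_SIGMA) simp_all
    ultimately have "gdelta_in euclidean (\<Inter>(C ` (UNIV \<times> I)))"
      using Cg by (intro gdelta_in_Inter) auto
    moreover have "open (\<Union>(W ` I))" using Wopen by (intro open_UN) blast
    ultimately show ?thesis
      unfolding D_def by (simp add: gdelta_in_Int cl op)
  qed
  ultimately show ?thesis
    using pull by (intro completely_metrizable_space_pullback[OF completely_metrizable_space_euclidean inj]) simp_all
qed

end

theorem mainTheorem3:
  fixes \<R> :: "('g::{polish_space, topological_group_add} \<Rightarrow> real) set"
    and act :: "'g \<Rightarrow> 'x \<Rightarrow> 'x"
    and \<tau> :: "'x topology"
    and \<F> :: "('x \<Rightarrow> real) set"
  assumes R_countable: "countable \<R>"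
    and R_basis: "graded_basis euclidean \<R>"
    and R_cosets: "\<And>\<rho>. \<rho> \<in> \<R> \<Longrightarrow>
          \<exists>H\<in>\<R>. \<exists>g. graded_subgroup H \<and> open_graded_subset euclidean H \<and> \<rho> = graded_coset H g"
    and R_max: "\<And>H K. \<lbrakk>H \<in> \<R>; K \<in> \<R>; graded_subgroup H; graded_subgroup K\<rbrakk> \<Longrightarrow>
          (\<lambda>g. max (H g) (K g)) \<in> \<R>"
    and R_scale: "\<And>H q. \<lbrakk>H \<in> \<R>; graded_subgroup H; q \<in> \<rat>; 0 < q\<rbrakk> \<Longrightarrow> dotted_scale q H \<in> \<R>"
    and R_conjugate: "\<And>H g. \<lbrakk>H \<in> \<R>; graded_subgroup H; graded_coset H g \<in> \<R>\<rbrakk> \<Longrightarrow>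
          graded_conjugate H g \<in> \<R>"
    and G_space: "polish_G_space act \<tau>"
    and F_countable: "countable \<F>"
    and F_borel: "\<And>\<phi>. \<phi> \<in> \<F> \<Longrightarrow> borel_graded_subset \<tau> \<phi>"
    and F_finer: "finer_topology (graded_generated_topology \<F>) \<tau>"
    and F_invariant: "\<And>\<phi>. \<phi> \<in> \<F> \<Longrightarrow> \<exists>H\<in>\<R>. graded_subgroup H \<and> graded_invariant act H \<phi>"
  shows "\<exists>t. nice_topology act \<tau> \<R> t \<and> (\<forall>\<phi>\<in>\<F>. open_graded_subset t \<phi>)"
proof -
  have pol: "polish_topology \<tau>" and act: "is_action act"
    using G_space by (auto simp: polish_G_space_def)
  have "open_graded_subset euclidean \<rho>" if "\<rho> \<in> \<R>" for \<rho>
    using R_basis that unfolding graded_basis_def by blast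
  then obtain f where f: "resolved \<tau> f" "\<F> \<subseteq> range f" "closed_family act \<R> (range f)"
    using closed_resolved_family_exists[OF G_space R_countable _ F_countable F_borel] by blast
  have countable_range: "countable (range f)" by simp
  interpret graded_coset_basis \<R> act "range f"
    by (rule graded_coset_basis.intro)
      (fact R_countable R_basis R_cosets R_max R_scale R_conjugate act countable_range f(3))+
  \<comment> \<open>Since \<open>\<F>\<close> consists of invariant functions, none of them is lost
    in passing to \<open>B\<close>. So \<open>tB\<close> still refines \<tau> and inherits the
    Hausdorff property that the embedding into real sequences requires.\<close>
  have FB: "\<F> \<subseteq> B" using f(2) F_invariant unfolding invariant_part_def by blast
  have finer: "finer_topology tB \<tau>"
    using F_finer graded_generated_mono[OF FB] unfolding finer_topology_def by blast
  then have "finer_topology tA \<tau>"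
    using graded_generated_mono[OF B_subset] unfolding finer_topology_def by blast
  then have tA: "completely_metrizable_space tA"
    by (intro resolved_completely_metrizable[OF pol f(1)] closed_family_neg[OF f(3)])
  have "Hausdorff_space \<tau>"
    using pol by (simp add: polish_topology_def completely_metrizable_imp_metrizable_space metrizable_imp_Hausdorff_space)
  then have "Hausdorff_space tB"
    using finer polish_topspace[OF pol] unfolding Hausdorff_space_def finer_topology_def
    by (simp only: graded_generated_topspace) meson
  then have "completely_metrizable_space tB" by (rule B_completely_metrizable[OF tA])
  moreover have "second_countable tB"
    unfolding second_countable
  proof (intro exI conjI)
    show "countable (basic_sublevels B)"
      by (intro countable_basic_sublevels countable_subset[OF B_subset A_countable])
    show "openin tB = arbitrary union_of (\<lambda>U. U \<in> basic_sublevels B)"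
      using B_graded_basis unfolding graded_basis_def is_basis_def basic_sublevels_def by blast
  qed
  ultimately have "polish_topology tB" by (simp add: polish_topology_def)
  moreover have "nice_basis act \<tau> \<R> B"
    unfolding nice_basis_def
  proof (intro conjI ballI impI)
    show "borel_graded_subset \<tau> \<phi>" if "\<phi> \<in> B" for \<phi>
      using that f(1) B_subset by (auto simp: resolved_def)
    show "countable B" by (rule countable_subset[OF B_subset A_countable])
    show "finer_topology tB \<tau>" by (rule finer)
    show "\<exists>H\<in>\<R>. graded_subgroup H \<and> open_graded_subset euclidean H \<and> graded_invariant act H \<phi>"
      if "\<phi> \<in> B" for \<phi>
      using that R_open unfolding invariant_part_def by blast
  qed (simp_all add: closed_family_neg[OF B_closed] closed_family_min[OF B_closed] closed_family_max[OF B_closed]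
      closed_family_abs[OF B_closed] closed_family_diff[OF B_closed] closed_family_add[OF B_closed]
      closed_family_scale[OF B_closed] closed_family_star[OF B_closed] closed_family_delta[OF B_closed])
  ultimately have "nice_topology act \<tau> \<R> tB"
    unfolding nice_topology_def using finer action_continuous B_graded_basis by blast
  moreover have "open_graded_subset tB \<phi>" if "\<phi> \<in> \<F>" for \<phi>
    using B_graded_basis that FB unfolding graded_basis_def by blast
  ultimately show ?thesis by blast
qed

end
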